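(* Let $G=(X,b,m)$ be a connected, locally finite weighted graph which is stochastically complete, let $x_0\in X$, and let $\kappa_\pm$ denote the outer and inner curvatures with respect to $x_0$. Let $f:X\to(0,\infty)$ be bounded and spherically symmetric with respect to $x_0$, such that for some $R$ one has $\widehat f(r):=f(r)-f(r+1)>0$ for all $r>R$, and such that $f(r)\not\to0$ as $r\to\infty$. If for some $\lambda<0$ $$\kappa_+(x)-\kappa_-(x)\,\frac{\widehat f(r-1)}{\widehat f(r)}\;\le\;\lambda\,\frac{f(r)}{\widehat f(r)}\qquad\text{for all }x\in S_r(x_0)\text{ and all } r>R,$$ then $G$ is not Feller.
   Context: Weighted graph: $G=(X,b,m)$ where $X$ is a countably infinite set (vertices), $b:X\times X\to[0,\infty)$ satisfies $b(x,y)=b(y,x)$, $b(x,x)=0$ and $|\{y : b(x,y)>0\}|<\infty$ for all $x$ (local finiteness), and $m:X\to(0,\infty)$ is a vertex measure. Write $x\sim y$ if $b(x,y)>0$. $G$ is connected if any two vertices are joined by a finite path $x=x_0\sim x_1\sim\dots\sim x_n=y$; $d(x,y)$ is the least number $n$ of edges of such a path (combinatorial graph metric). Laplacian and heat semigroup: the formal Laplacian is $\widetilde\Delta f(x)=\frac1{m(x)}\sum_{y\in X}b(x,y)(f(x)-f(y))$ for $f:X\to\mathbb{R}$. $C_c(X)$ is the space of finitely supported real functions, and $\ell^2(X,m)$ is the Hilbert space of real functions with $\sum_x f(x)^2m(x)<\infty$, with inner product $\langle f,g\rangle=\sum_x f(x)g(x)m(x)$. $\Delta$ is the Friedrichs extension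 in $\ell^2(X,m)$ of $\widetilde\Delta|_{C_c(X)}$, i.e. the self-adjoint operator of the closure of the form $\frac12\sum_{x,y}b(x,y)(f(x)-f(y))(g(x)-g(y))$ on $C_c(X)$. The semigroup $P_t=e^{-t\Delta}$ has a heat kernel $p_t(x,y)\ge 0$ and acts on bounded functions by $P_tf(x)=\sum_{y\in X}p_t(x,y)f(y)m(y)$. Stochastically complete: $\sum_{y\in X}p_t(x,y)m(y)=1$ for all $x\in X$ and $t\ge0$. Feller: $C_0(X)$ is the space of functions vanishing at infinity, i.e. the closure of $C_c(X)$ in the sup norm. $G$ is Feller if $P_t$ maps $C_0(X)$ into $C_0(X)$ for all $t\ge0$. Curvatures: for $x_0\in X$ and integer $r$ let $S_r(x_0)=\{y : d(y,x_0)=r\}$ (empty if $r<0$). For $x\in S_r(x_0)$, the outer ($+$) and inner ($-$) curvatures with respect to $x_0$ are $\kappa_\pm(x)=\frac1{m(x)}\sum_{y\in S_{r\pm1}(x_0)}b(x,y)$. A function $f$ on $X$ is spherically symmetric with respect to $x_0$ if its values depend only on the distance $d(\cdot,x_0)$; then $f(r)$ denotes the common value of $f$ on $S_r(x_0)$. Here $r$ and $R$ denote nonnegative integers. *)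

theory Defs
  imports "HOL-Analysis.Analysis"
begin

text \<open>The vertex set \<open>X\<close> is the whole type \<open>'a\<close>.\<close>

locale weighted_graph =
  fixes b :: "'a \<Rightarrow> 'a \<Rightarrow> real" and m :: "'a \<Rightarrow> real"
  assumes countable_vertices: "countable (UNIV :: 'a set)"
    and infinite_vertices: "infinite (UNIV :: 'a set)"
    and weight_nonneg: "0 \<le> b x y"
    and weight_sym: "b x y = b y x"
    and weight_diag: "b x x = 0"
    and locally_finite: "finite {y. b x y > 0}"
    and measure_pos: "0 < m x"

definition adj :: "('a \<Rightarrow> 'a \<Rightarrow> real) \<Rightarrow> 'a \<Rightarrow> 'a \<Rightarrow> bool" where
  "adj b x y \<longleftrightarrow> b x y > 0"

definition graph_connected :: "('a \<Rightarrow> 'a \<Rightarrow> real) \<Rightarrow> bool" where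
  "graph_connected b \<longleftrightarrow> (\<forall>x y. \<exists>n. (adj b ^^ n) x y)"

text \<open>Combinatorial graph metric; only meaningful on connected graphs.\<close>

definition graph_dist :: "('a \<Rightarrow> 'a \<Rightarrow> real) \<Rightarrow> 'a \<Rightarrow> 'a \<Rightarrow> nat" where
  "graph_dist b x y = (LEAST n. (adj b ^^ n) x y)"


section \<open>Function spaces\<close>

definition Cc :: "('a \<Rightarrow> real) set" where
  "Cc = {f. finite {x. f x \<noteq> 0}}"

text \<open>Closure of \<^const>\<open>Cc\<close> in the sup norm, i.e. its uniform limits.\<close>

definition C0 :: "('a \<Rightarrow> real) set" where
  "C0 = {f. \<exists>\<phi> :: nat \<Rightarrow> 'a \<Rightarrow> real. (\<forall>n. \<phi> n \<in> Cc) \<and> uniform_limit UNIV \<phi> f sequentially}"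

definition l2 :: "('a \<Rightarrow> real) \<Rightarrow> ('a \<Rightarrow> real) set" where
  "l2 m = {f. (\<lambda>x. (f x)\<^sup>2 * m x) summable_on UNIV}"

definition l2_inner :: "('a \<Rightarrow> real) \<Rightarrow> ('a \<Rightarrow> real) \<Rightarrow> ('a \<Rightarrow> real) \<Rightarrow> real" where
  "l2_inner m f g = (\<Sum>\<^sub>\<infinity>x. f x * g x * m x)"

definition l2_norm :: "('a \<Rightarrow> real) \<Rightarrow> ('a \<Rightarrow> real) \<Rightarrow> real" where
  "l2_norm m f = sqrt (l2_inner m f f)"


section \<open>The Friedrichs extension of the Laplacian\<close>

definition energy ::
    "('a \<Rightarrow> 'a \<Rightarrow> real) \<Rightarrow> ('a \<Rightarrow> real) \<Rightarrow> ('a \<Rightarrow> real) \<Rightarrow> real" where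
  "energy b f g = (\<Sum>\<^sub>\<infinity>(x, y). b x y * (f x - f y) * (g x - g y)) / 2"

text \<open>The sequence \<open>\<phi>\<close> in \<^const>\<open>Cc\<close> converges to \<open>f\<close> in \<open>\<ell>\<^sup>2(X,m)\<close> and is Cauchy for the energy.\<close>

definition form_approx ::
    "('a \<Rightarrow> 'a \<Rightarrow> real) \<Rightarrow> ('a \<Rightarrow> real) \<Rightarrow> (nat \<Rightarrow> 'a \<Rightarrow> real) \<Rightarrow> ('a \<Rightarrow> real) \<Rightarrow> bool" where
  "form_approx b m \<phi> f \<longleftrightarrow>
     (\<forall>n. \<phi> n \<in> Cc) \<and> f \<in> l2 m \<and>
     (\<lambda>n. l2_norm m (\<lambda>x. \<phi> n x - f x)) \<longlonglongrightarrow> 0 \<and>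
     (\<forall>\<epsilon>>0. \<exists>N. \<forall>i\<ge>N. \<forall>j\<ge>N.
        energy b (\<lambda>x. \<phi> i x - \<phi> j x) (\<lambda>x. \<phi> i x - \<phi> j x) < \<epsilon>)"

definition form_domain :: "('a \<Rightarrow> 'a \<Rightarrow> real) \<Rightarrow> ('a \<Rightarrow> real) \<Rightarrow> ('a \<Rightarrow> real) set" where
  "form_domain b m = {f. \<exists>\<phi>. form_approx b m \<phi> f}"

text \<open>
  For \<open>f, g\<close> in \<^const>\<open>form_domain\<close>: the closure of the energy form on \<^const>\<open>Cc\<close> takes the
  value \<open>q\<close> at \<open>(f, g)\<close>.
\<close>

definition has_closed_energy ::
    "('a \<Rightarrow> 'a \<Rightarrow> real) \<Rightarrow> ('a \<Rightarrow> real) \<Rightarrow> ('a \<Rightarrow> real) \<Rightarrow> ('a \<Rightarrow> real) \<Rightarrow> real \<Rightarrow> bool" where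
  "has_closed_energy b m f g q \<longleftrightarrow>
     (\<forall>\<phi> \<psi>. form_approx b m \<phi> f \<longrightarrow> form_approx b m \<psi> g \<longrightarrow>
        (\<lambda>n. energy b (\<phi> n) (\<psi> n)) \<longlonglongrightarrow> q)"

text \<open>
  The graph of the unbounded operator \<open>\<Delta>\<close> associated with the closed form: the relation holds
  iff \<open>f \<in> D(\<Delta>)\<close> and \<open>\<Delta> f = h\<close>.
\<close>

definition friedrichs_laplacian ::
    "('a \<Rightarrow> 'a \<Rightarrow> real) \<Rightarrow> ('a \<Rightarrow> real) \<Rightarrow> ('a \<Rightarrow> real) \<Rightarrow> ('a \<Rightarrow> real) \<Rightarrow> bool" where
  "friedrichs_laplacian b m f h \<longleftrightarrow>
     f \<in> form_domain b m \<and> h \<in> l2 m \<and>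
     (\<forall>g \<in> form_domain b m. has_closed_energy b m f g (l2_inner m h g))"


section \<open>Heat semigroup and heat kernel\<close>

text \<open>
  \<open>P t = e\<^sup>-\<^sup>t\<^sup>\<Delta>\<close>: the strongly continuous semigroup of bounded operators on \<open>\<ell>\<^sup>2(X,m)\<close>
  whose infinitesimal generator, domain included, is \<open>-\<Delta>\<close>.
\<close>

definition heat_semigroup ::
    "('a \<Rightarrow> 'a \<Rightarrow> real) \<Rightarrow> ('a \<Rightarrow> real) \<Rightarrow> (real \<Rightarrow> ('a \<Rightarrow> real) \<Rightarrow> 'a \<Rightarrow> real) \<Rightarrow> bool" where
  "heat_semigroup b m P \<longleftrightarrow>
     (\<forall>t\<ge>0. \<forall>f\<in>l2 m. P t f \<in> l2 m) \<and>
     (\<forall>t\<ge>0. \<forall>f\<in>l2 m. \<forall>g\<in>l2 m. \<forall>\<alpha> \<beta>.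
        P t (\<lambda>x. \<alpha> * f x + \<beta> * g x) = (\<lambda>x. \<alpha> * P t f x + \<beta> * P t g x)) \<and>
     (\<forall>t\<ge>0. \<exists>C. \<forall>f\<in>l2 m. l2_norm m (P t f) \<le> C * l2_norm m f) \<and>
     (\<forall>f\<in>l2 m. P 0 f = f) \<and>
     (\<forall>s\<ge>0. \<forall>t\<ge>0. \<forall>f\<in>l2 m. P (s + t) f = P s (P t f)) \<and>
     (\<forall>f\<in>l2 m. ((\<lambda>t. l2_norm m (\<lambda>x. P t f x - f x)) \<longlongrightarrow> 0) (at_right 0)) \<and>
     (\<forall>f\<in>l2 m. \<forall>h\<in>l2 m. friedrichs_laplacian b m f h \<longleftrightarrow>
        ((\<lambda>t. l2_norm m (\<lambda>x. (P t f x - f x) / t - (- h x))) \<longlongrightarrow> 0) (at_right 0))"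

definition heat_kernel ::
    "('a \<Rightarrow> 'a \<Rightarrow> real) \<Rightarrow> ('a \<Rightarrow> real) \<Rightarrow> (real \<Rightarrow> 'a \<Rightarrow> 'a \<Rightarrow> real) \<Rightarrow> bool" where
  "heat_kernel b m p \<longleftrightarrow>
     (\<forall>t\<ge>0. \<forall>x y. 0 \<le> p t x y) \<and>
     (\<exists>P. heat_semigroup b m P \<and>
        (\<forall>t\<ge>0. \<forall>f\<in>l2 m. \<forall>x. ((\<lambda>y. p t x y * f y * m y) has_sum P t f x) UNIV))"

text \<open>The action of the semigroup on bounded functions.\<close>

definition heat_action ::
    "('a \<Rightarrow> real) \<Rightarrow> (real \<Rightarrow> 'a \<Rightarrow> 'a \<Rightarrow> real) \<Rightarrow> real \<Rightarrow> ('a \<Rightarrow> real) \<Rightarrow> 'a \<Rightarrow> real" where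
  "heat_action m p t f x = (\<Sum>\<^sub>\<infinity>y. p t x y * f y * m y)"

text \<open>
  In the following two definitions \<open>p\<close> is meant to be the heat kernel of the graph, which is
  uniquely determined by \<open>b\<close> and \<open>m\<close>.
\<close>

definition stochastically_complete ::
    "('a \<Rightarrow> real) \<Rightarrow> (real \<Rightarrow> 'a \<Rightarrow> 'a \<Rightarrow> real) \<Rightarrow> bool" where
  "stochastically_complete m p \<longleftrightarrow>
     (\<forall>x. \<forall>t\<ge>0. ((\<lambda>y. p t x y * m y) has_sum 1) UNIV)"

definition feller :: "('a \<Rightarrow> real) \<Rightarrow> (real \<Rightarrow> 'a \<Rightarrow> 'a \<Rightarrow> real) \<Rightarrow> bool" where
  "feller m p \<longleftrightarrow> (\<forall>t\<ge>0. \<forall>f\<in>C0. heat_action m p t f \<in> C0)"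


section \<open>Spheres, curvatures, spherical symmetry\<close>

definition graph_sphere :: "('a \<Rightarrow> 'a \<Rightarrow> real) \<Rightarrow> 'a \<Rightarrow> int \<Rightarrow> 'a set" where
  "graph_sphere b x0 r = {y. int (graph_dist b y x0) = r}"

definition outer_curvature ::
    "('a \<Rightarrow> 'a \<Rightarrow> real) \<Rightarrow> ('a \<Rightarrow> real) \<Rightarrow> 'a \<Rightarrow> 'a \<Rightarrow> real" where
  "outer_curvature b m x0 x =
     (\<Sum>\<^sub>\<infinity>y\<in>graph_sphere b x0 (int (graph_dist b x x0) + 1). b x y) / m x"

definition inner_curvature ::
    "('a \<Rightarrow> 'a \<Rightarrow> real) \<Rightarrow> ('a \<Rightarrow> real) \<Rightarrow> 'a \<Rightarrow> 'a \<Rightarrow> real" where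
  "inner_curvature b m x0 x =
     (\<Sum>\<^sub>\<infinity>y\<in>graph_sphere b x0 (int (graph_dist b x x0) - 1). b x y) / m x"

definition spherically_symmetric ::
    "('a \<Rightarrow> 'a \<Rightarrow> real) \<Rightarrow> 'a \<Rightarrow> ('a \<Rightarrow> real) \<Rightarrow> bool" where
  "spherically_symmetric b x0 f \<longleftrightarrow>
     (\<forall>x y. graph_dist b x x0 = graph_dist b y x0 \<longrightarrow> f x = f y)"

text \<open>
  The common value \<open>f(r)\<close> of a spherically symmetric \<open>f\<close> on the sphere of radius \<open>r\<close>; on an
  infinite, connected, locally finite graph all these spheres are nonempty.
\<close>

definition radial_value ::
    "('a \<Rightarrow> 'a \<Rightarrow> real) \<Rightarrow> 'a \<Rightarrow> ('a \<Rightarrow> real) \<Rightarrow> nat \<Rightarrow> real" where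
  "radial_value b x0 f r = (THE c. f ` graph_sphere b x0 (int r) = {c})"

definition radial_diff ::
    "('a \<Rightarrow> 'a \<Rightarrow> real) \<Rightarrow> 'a \<Rightarrow> ('a \<Rightarrow> real) \<Rightarrow> nat \<Rightarrow> real" where
  "radial_diff b x0 f r = radial_value b x0 f r - radial_value b x0 f (r + 1)"

end

theory Submission
  imports Defs
begin

text \<open>
  Put \<open>\<mu> = - \<lambda> > 0\<close>. Multiplied by the positive radial difference of \<open>f\<close>, the curvature condition
  says that \<open>(\<Delta> + \<mu>) f \<le> 0\<close> outside the ball \<open>K\<close> of radius \<open>R\<close> around \<open>x0\<close>
  (\<open>formal_laplacian_spherically_symmetric\<close>). So \<open>f\<close> is a bounded subsolution off a finite set, and
  since its radial values decrease to a positive limit, it stays above a constant \<open>c > 0\<close> there.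
  Stochastic completeness forces such a function below a resolvent of a function supported on \<open>K\<close>,
  whereas the Feller property makes that resolvent vanish at infinity; both together contradict
  \<open>f \<ge> c\<close>.

  The comparison functions are the truncated resolvents \<open>U = \<integral>\<^sub>0\<^sup>T e\<^sup>-\<^sup>\<mu>\<^sup>t P\<^sub>t g dt\<close> with \<open>g\<close>
  finitely supported. They lie in the domain of the Friedrichs extension and satisfy
  \<open>(\<Delta> + \<mu>) U = g - e\<^sup>-\<^sup>\<mu>\<^sup>T P\<^sub>T g\<close> (\<open>friedrichs_laplacian_discounted\<close>), which is read off from the
  generator once the integral makes sense. Continuity of \<open>t \<mapsto> P\<^sub>t g(x)\<close> is obtained from
  strong continuity at 0 by comparing the probability densities \<open>p\<^sub>t(x, \<cdot>)\<close> at different times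
  (\<open>P_time_modulus\<close>).

  The comparison itself is a maximum principle (\<open>subsolution_comparison\<close>): a subsolution that lies
  below a nonnegative element of the form domain is nonpositive. It is applied to
  \<open>f - U - \<epsilon> - (M - v)\<close>, where \<open>f \<le> M\<close>, \<open>U\<close> belongs to a multiple of the indicator of \<open>K\<close>,
  \<open>\<epsilon>\<close> is a constant that tends to 0 as \<open>T\<close> grows, and \<open>v\<close> is the truncated resolvent of
  \<open>\<mu> M\<close> times the indicator of a large finite set. Stochastic completeness makes \<open>v\<close> increase to
  \<open>M\<close> as the set and its truncation time grow, which leaves \<open>f \<le> U + \<epsilon>\<close> (\<open>bounded_exterior_subsolution_le\<close>).
\<close>

section \<open>Square-summable functions on a weighted graph\<close>

context weighted_graph
begin

lemma m_nonneg: "0 \<le> m x"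
  using measure_pos[of x] by simp

lemma sum_sq_nonneg: "0 \<le> (\<Sum>x\<in>F. (f x)\<^sup>2 * m x)"
  by (intro sum_nonneg mult_nonneg_nonneg m_nonneg zero_le_power2)

lemma sq_weight_L2_set:
  "L2_set (\<lambda>x. f x * sqrt (m x)) F = sqrt (\<Sum>x\<in>F. (f x)\<^sup>2 * m x)"
  by (simp add: L2_set_def power_mult_distrib m_nonneg)

lemma l2_norm_eq: "l2_norm m f = sqrt (\<Sum>\<^sub>\<infinity>x. (f x)\<^sup>2 * m x)"
  by (simp add: l2_norm_def l2_inner_def power2_eq_square)

lemma l2_norm_nonneg: "0 \<le> l2_norm m f"
  unfolding l2_norm_eq by (simp add: infsum_nonneg m_nonneg)

lemma l2I:
  assumes "0 \<le> B" and "\<And>F. finite F \<Longrightarrow> L2_set (\<lambda>x. f x * sqrt (m x)) F \<le> B"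
  shows "f \<in> l2 m" and "l2_norm m f \<le> B"
proof -
  have fin: "(\<Sum>x\<in>F. (f x)\<^sup>2 * m x) \<le> B\<^sup>2" if "finite F" for F
    using assms(2)[OF that] assms(1) real_le_lsqrt sqrt_le_D
    unfolding sq_weight_L2_set by blast
  have summ: "(\<lambda>x. (f x)\<^sup>2 * m x) summable_on UNIV"
    by (rule nonneg_bdd_above_summable_on) (auto intro!: bdd_aboveI2 fin simp: m_nonneg)
  then show "f \<in> l2 m"
    by (simp add: l2_def)
  have "(\<Sum>\<^sub>\<infinity>x. (f x)\<^sup>2 * m x) \<le> B\<^sup>2"
    using summ fin by (intro infsum_le_finite_sums) auto
  then show "l2_norm m f \<le> B"
    unfolding l2_norm_eq using assms(1) real_le_lsqrt by (simp add: real_le_lsqrt)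
qed

lemma L2_set_le_l2_norm:
  assumes "f \<in> l2 m" and "finite F"
  shows "L2_set (\<lambda>x. f x * sqrt (m x)) F \<le> l2_norm m f"
  unfolding sq_weight_L2_set l2_norm_eq using assms
  by (auto intro!: finite_sum_le_infsum simp: l2_def m_nonneg)

lemma Cc_subset_l2: "f \<in> Cc \<Longrightarrow> f \<in> l2 m"
  unfolding l2_def Cc_def
  by (auto intro!: finite_nonzero_values_imp_summable_on elim: finite_subset[rotated])

lemma l2_add:
  assumes "f \<in> l2 m" and "g \<in> l2 m"
  shows "(\<lambda>x. f x + g x) \<in> l2 m"
    and "l2_norm m (\<lambda>x. f x + g x) \<le> l2_norm m f + l2_norm m g"
proof -
  have *: "L2_set (\<lambda>x. (f x + g x) * sqrt (m x)) F \<le> l2_norm m f + l2_norm m g"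
    if "finite F" for F
    using L2_set_triangle_ineq[of "\<lambda>x. f x * sqrt (m x)" "\<lambda>x. g x * sqrt (m x)" F]
      L2_set_le_l2_norm[OF assms(1) that] L2_set_le_l2_norm[OF assms(2) that]
    by (simp add: distrib_right)
  show "(\<lambda>x. f x + g x) \<in> l2 m" "l2_norm m (\<lambda>x. f x + g x) \<le> l2_norm m f + l2_norm m g"
    using l2I[OF _ *] l2_norm_nonneg[of f] l2_norm_nonneg[of g] by simp_all
qed

lemma l2_scale:
  assumes "f \<in> l2 m"
  shows "(\<lambda>x. c * f x) \<in> l2 m" and "l2_norm m (\<lambda>x. c * f x) \<le> \<bar>c\<bar> * l2_norm m f"
proof -
  have *: "L2_set (\<lambda>x. (c * f x) * sqrt (m x)) F \<le> \<bar>c\<bar> * l2_norm m f" if "finite F" for F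
  proof -
    have "L2_set (\<lambda>x. (c * f x) * sqrt (m x)) F = L2_set (\<lambda>x. \<bar>c\<bar> * (f x * sqrt (m x))) F"
      by (simp add: L2_set_def power_mult_distrib mult.assoc)
    also have "\<dots> = \<bar>c\<bar> * L2_set (\<lambda>x. f x * sqrt (m x)) F"
      by (simp add: L2_set_right_distrib)
    also have "\<dots> \<le> \<bar>c\<bar> * l2_norm m f"
      by (intro mult_left_mono L2_set_le_l2_norm assms that) auto
    finally show ?thesis .
  qed
  show "(\<lambda>x. c * f x) \<in> l2 m" "l2_norm m (\<lambda>x. c * f x) \<le> \<bar>c\<bar> * l2_norm m f"
    using l2I[OF _ *] l2_norm_nonneg[of f] by simp_all
qed

lemma l2_diff:
  assumes "f \<in> l2 m" and "g \<in> l2 m"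
  shows "(\<lambda>x. f x - g x) \<in> l2 m"
    and "l2_norm m (\<lambda>x. f x - g x) \<le> l2_norm m f + l2_norm m g"
  using l2_add[OF assms(1) l2_scale(1)[OF assms(2), of "-1"]] l2_scale(2)[OF assms(2), of "-1"]
  by simp_all

lemma abs_le_l2_norm:
  assumes "f \<in> l2 m"
  shows "\<bar>f x\<bar> \<le> l2_norm m f / sqrt (m x)"
  using L2_set_le_l2_norm[OF assms, of "{x}"] measure_pos[of x]
  by (simp add: L2_set_def abs_mult power_mult_distrib real_sqrt_mult field_simps)

lemma tendsto_pointwise_if_l2:
  assumes "((\<lambda>n. l2_norm m (\<lambda>x. \<phi> n x - f x)) \<longlongrightarrow> 0) \<F>"
    and "eventually (\<lambda>n. \<phi> n \<in> l2 m) \<F>" and "f \<in> l2 m"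
  shows "((\<lambda>n. \<phi> n x) \<longlongrightarrow> f x) \<F>"
proof -
  have "((\<lambda>n. l2_norm m (\<lambda>x. \<phi> n x - f x) / sqrt (m x)) \<longlongrightarrow> 0) \<F>"
    using tendsto_mult_right[OF assms(1), of "1 / sqrt (m x)"] by simp
  then have "((\<lambda>n. \<phi> n x - f x) \<longlongrightarrow> 0) \<F>"
    by (rule Lim_null_comparison[rotated])
      (use assms(2) in eventually_elim, use abs_le_l2_norm l2_diff(1) assms(3) in auto)
  then show ?thesis
    by (simp add: LIM_zero_iff)
qed

text \<open>
  Minkowski's integral inequality. It suffices to bound the norm over finitely many vertices, and
  there the integral can be paired with itself under the integral sign, so that Cauchy--Schwarz
  gives \<open>N\<^sup>2 \<le> (d - c) B N\<close> for that norm \<open>N\<close>.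
\<close>

lemma l2_integral:
  fixes \<psi> :: "real \<Rightarrow> 'a \<Rightarrow> real"
  assumes "c \<le> d" and "0 \<le> B"
    and cont: "\<And>x. continuous_on {c..d} (\<lambda>t. \<psi> t x)"
    and l2: "\<And>t. t \<in> {c..d} \<Longrightarrow> \<psi> t \<in> l2 m"
    and le: "\<And>t. t \<in> {c..d} \<Longrightarrow> l2_norm m (\<psi> t) \<le> B"
  shows "(\<lambda>x. integral {c..d} (\<lambda>t. \<psi> t x)) \<in> l2 m"
    and "l2_norm m (\<lambda>x. integral {c..d} (\<lambda>t. \<psi> t x)) \<le> (d - c) * B"
proof -
  let ?I = "\<lambda>x. integral {c..d} (\<lambda>t. \<psi> t x)"
  have *: "L2_set (\<lambda>x. ?I x * sqrt (m x)) F \<le> (d - c) * B" if "finite F" for F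
  proof -
    define N where "N = L2_set (\<lambda>x. ?I x * sqrt (m x)) F"
    have N0: "0 \<le> N" by (simp add: N_def L2_set_nonneg)
    have "((\<lambda>t. \<Sum>x\<in>F. \<psi> t x * (?I x * m x)) has_integral (\<Sum>x\<in>F. ?I x * (?I x * m x))) {c..d}"
      by (intro has_integral_sum that has_integral_mult_left integrable_integral
          integrable_continuous_interval cont)
    moreover have "(\<Sum>x\<in>F. ?I x * (?I x * m x)) = N\<^sup>2"
      unfolding N_def sq_weight_L2_set real_sqrt_pow2_iff[THEN iffD2, OF sum_sq_nonneg]
      by (simp add: power2_eq_square mult.assoc)
    ultimately have int: "((\<lambda>t. \<Sum>x\<in>F. \<psi> t x * (?I x * m x)) has_integral N\<^sup>2) {c..d}"
      by simp
    have "(\<Sum>x\<in>F. \<psi> t x * (?I x * m x)) \<le> B * N" if t: "t \<in> {c..d}" for t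
    proof -
      have "(\<Sum>x\<in>F. \<psi> t x * (?I x * m x))
          \<le> (\<Sum>x\<in>F. \<bar>\<psi> t x * sqrt (m x)\<bar> * \<bar>?I x * sqrt (m x)\<bar>)"
      proof (rule sum_mono)
        fix x
        have "\<psi> t x * (?I x * m x) = (\<psi> t x * sqrt (m x)) * (?I x * sqrt (m x))"
          using m_nonneg[of x] by (simp add: algebra_simps flip: power2_eq_square)
        then show "\<psi> t x * (?I x * m x) \<le> \<bar>\<psi> t x * sqrt (m x)\<bar> * \<bar>?I x * sqrt (m x)\<bar>"
          by (metis abs_ge_self abs_mult)
      qed
      also have "\<dots> \<le> L2_set (\<lambda>x. \<psi> t x * sqrt (m x)) F * N"
        unfolding N_def by (rule L2_set_mult_ineq)
      also have "\<dots> \<le> B * N"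
        using L2_set_le_l2_norm[OF l2[OF t] \<open>finite F\<close>] le[OF t] N0
        by (intro mult_right_mono) auto
      finally show ?thesis .
    qed
    then have "N\<^sup>2 \<le> (d - c) * (B * N)"
      using has_integral_le[OF int has_integral_const_real[of "B * N" c d]] assms(1) by simp
    then have "N * N \<le> ((d - c) * B) * N"
      by (simp add: power2_eq_square algebra_simps)
    then have "N \<le> (d - c) * B"
      using N0 assms(1,2) by (cases "N = 0") (auto simp: mult_le_cancel_right)
    then show ?thesis by (simp add: N_def)
  qed
  show "?I \<in> l2 m" "l2_norm m ?I \<le> (d - c) * B"
    using l2I[OF _ *] assms(1,2) by simp_all
qed

end

section \<open>The Laplacian and the energy form\<close>

definition formal_laplacian ::
    "('a \<Rightarrow> 'a \<Rightarrow> real) \<Rightarrow> ('a \<Rightarrow> real) \<Rightarrow> ('a \<Rightarrow> real) \<Rightarrow> 'a \<Rightarrow> real" where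
  "formal_laplacian b m f x = (\<Sum>y | b x y > 0. b x y * (f x - f y)) / m x"

context weighted_graph
begin

lemma formal_laplacian_times_m:
  "formal_laplacian b m f x * m x = (\<Sum>y | b x y > 0. b x y * (f x - f y))"
  using measure_pos[of x] by (simp add: formal_laplacian_def)

lemma formal_laplacian_lincomb:
  "formal_laplacian b m (\<lambda>x. c * f x + d * g x) x
    = c * formal_laplacian b m f x + d * formal_laplacian b m g x"
  unfolding formal_laplacian_def
  by (simp add: sum_distrib_left algebra_simps add_divide_distrib sum.distrib sum_subtractf
      diff_divide_distrib)

lemma formal_laplacian_diff:
  "formal_laplacian b m (\<lambda>x. f x - g x) x = formal_laplacian b m f x - formal_laplacian b m g x"
  using formal_laplacian_lincomb[of 1 f "-1" g x] by simp

lemma formal_laplacian_const: "formal_laplacian b m (\<lambda>_. c) x = 0"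
  by (simp add: formal_laplacian_def)

lemma formal_laplacian_mono_at:
  assumes "f x = g x" and "\<And>y. g y \<le> f y"
  shows "formal_laplacian b m f x \<le> formal_laplacian b m g x"
  unfolding formal_laplacian_def using assms m_nonneg
  by (auto intro!: divide_right_mono sum_mono mult_left_mono weight_nonneg)

lemma tendsto_formal_laplacian:
  assumes "\<And>x. ((\<lambda>n. \<phi> n x) \<longlongrightarrow> f x) \<F>"
  shows "((\<lambda>n. formal_laplacian b m (\<phi> n) x) \<longlongrightarrow> formal_laplacian b m f x) \<F>"
proof -
  have "((\<lambda>n. formal_laplacian b m (\<phi> n) x * m x) \<longlongrightarrow> formal_laplacian b m f x * m x) \<F>"
    unfolding formal_laplacian_times_m by (intro tendsto_intros assms)
  from tendsto_divide[OF this tendsto_const, of "m x"] show ?thesis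
    using measure_pos[of x] by simp
qed

lemma energy_sym: "energy b f g = energy b g f"
  unfolding energy_def by (simp add: mult.assoc mult.commute[of "f _ - f _"])

lemma energy_nonneg: "0 \<le> energy b f f"
proof -
  have "0 \<le> b x y * (f x - f y) * (f x - f y)" for x y
    by (simp add: mult.assoc weight_nonneg)
  then show ?thesis
    unfolding energy_def by (auto intro!: divide_nonneg_nonneg infsum_nonneg split: prod.splits)
qed

text \<open>
  Summation by parts. Only pairs inside the finite set \<open>N\<close> of vertices in or next to the support
  of \<open>\<zeta>\<close> contribute, and exchanging the two ends of an edge turns the terms with \<open>\<zeta> y\<close> into
  those with \<open>\<zeta> x\<close>.
\<close>

lemma energy_Green:
  assumes "finite S" and "\<And>x. x \<notin> S \<Longrightarrow> \<zeta> x = 0"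
  shows "energy b f \<zeta> = (\<Sum>x\<in>S. formal_laplacian b m f x * \<zeta> x * m x)"
proof -
  define N where "N = S \<union> (\<Union>x\<in>S. {y. b x y > 0})"
  have finN: "finite N" using assms(1) locally_finite by (auto simp: N_def)
  have zero: "b x y = 0" if "\<not> b x y > 0" for x y
    using weight_nonneg[of x y] that by linarith
  have out: "b x y * (f x - f y) * (\<zeta> x - \<zeta> y) = 0" if "(x, y) \<notin> N \<times> N" for x y
  proof (cases "b x y > 0")
    case True
    then have "b y x > 0" by (simp add: weight_sym)
    with True that have "x \<notin> S \<and> y \<notin> S" by (auto simp: N_def)
    then show ?thesis by (simp add: assms(2))
  qed (simp add: zero)
  have "(\<Sum>\<^sub>\<infinity>(x, y). b x y * (f x - f y) * (\<zeta> x - \<zeta> y))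
      = (\<Sum>\<^sub>\<infinity>(x, y)\<in>N \<times> N. b x y * (f x - f y) * (\<zeta> x - \<zeta> y))"
  proof (rule infsum_cong_neutral)
    fix z assume "z \<in> UNIV - N \<times> N"
    then show "(case z of (x, y) \<Rightarrow> b x y * (f x - f y) * (\<zeta> x - \<zeta> y)) = 0"
      using out[of "fst z" "snd z"] by (simp only: case_prod_unfold) (simp add: mem_Times_iff)
  qed auto
  also have "\<dots> = (\<Sum>x\<in>N. \<Sum>y\<in>N. b x y * (f x - f y) * (\<zeta> x - \<zeta> y))"
    using finN by (simp add: sum.cartesian_product)
  also have "\<dots> = (\<Sum>x\<in>N. \<Sum>y\<in>N. b x y * (f x - f y) * \<zeta> x)
      + (\<Sum>x\<in>N. \<Sum>y\<in>N. b x y * (f y - f x) * \<zeta> y)"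
    by (simp add: algebra_simps flip: sum.distrib)
  also have "(\<Sum>x\<in>N. \<Sum>y\<in>N. b x y * (f y - f x) * \<zeta> y)
      = (\<Sum>x\<in>N. \<Sum>y\<in>N. b x y * (f x - f y) * \<zeta> x)"
    by (subst sum.swap) (simp add: weight_sym)
  finally have "energy b f \<zeta> = (\<Sum>x\<in>N. \<Sum>y\<in>N. b x y * (f x - f y) * \<zeta> x)"
    by (simp add: energy_def)
  also have "\<dots> = (\<Sum>x\<in>S. \<Sum>y\<in>N. b x y * (f x - f y) * \<zeta> x)"
    using finN assms(2) by (intro sum.mono_neutral_right) (auto simp: N_def)
  also have "\<dots> = (\<Sum>x\<in>S. formal_laplacian b m f x * \<zeta> x * m x)"
  proof (rule sum.cong)
    fix x assume "x \<in> S"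
    then have "(\<Sum>y\<in>N. b x y * (f x - f y) * \<zeta> x)
        = (\<Sum>y | b x y > 0. b x y * (f x - f y) * \<zeta> x)"
      using finN zero by (intro sum.mono_neutral_right) (auto simp: N_def)
    also have "\<dots> = formal_laplacian b m f x * m x * \<zeta> x"
      by (simp add: formal_laplacian_times_m sum_distrib_right)
    finally show "(\<Sum>y\<in>N. b x y * (f x - f y) * \<zeta> x) = formal_laplacian b m f x * \<zeta> x * m x"
      by (simp add: mult.commute mult.left_commute)
  qed simp
  finally show ?thesis .
qed

lemma Cc_diff: "f \<in> Cc \<Longrightarrow> g \<in> Cc \<Longrightarrow> (\<lambda>x. f x - g x) \<in> Cc"
proof -
  assume "f \<in> Cc" and "g \<in> Cc"
  moreover have "{x. f x - g x \<noteq> 0} \<subseteq> {x. f x \<noteq> 0} \<union> {x. g x \<noteq> 0}"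
    by auto
  ultimately show "(\<lambda>x. f x - g x) \<in> Cc"
    unfolding Cc_def using finite_subset by blast
qed

lemma energy_le_half_sum:
  assumes "f \<in> Cc" and "g \<in> Cc"
  shows "energy b f g \<le> (energy b f f + energy b g g) / 2"
proof -
  define S where "S = {x. f x \<noteq> 0} \<union> {x. g x \<noteq> 0}"
  have S: "finite S" "\<And>x. x \<notin> S \<Longrightarrow> f x = 0" "\<And>x. x \<notin> S \<Longrightarrow> g x = 0"
    using assms by (auto simp: S_def Cc_def)
  have diff: "energy b (\<lambda>x. u x - v x) z = energy b u z - energy b v z"
    if "\<And>x. x \<notin> S \<Longrightarrow> z x = 0" for u v z
    by (subst (1 2 3) energy_Green[OF S(1) that])
      (auto simp: formal_laplacian_diff algebra_simps sum_subtractf)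
  let ?d = "\<lambda>x. f x - g x"
  have "energy b ?d ?d = energy b f ?d - energy b g ?d"
    using S by (intro diff) auto
  also have "\<dots> = energy b ?d f - energy b ?d g"
    by (simp add: energy_sym)
  also have "\<dots> = (energy b f f - energy b g f) - (energy b f g - energy b g g)"
    using S by (simp add: diff)
  finally show ?thesis
    using energy_nonneg[of ?d] energy_sym[of f g] by simp
qed

lemma form_approx_tendsto:
  assumes "form_approx b m \<phi> f"
  shows "(\<lambda>n. \<phi> n x) \<longlonglongrightarrow> f x"
proof (rule tendsto_pointwise_if_l2)
  show "(\<lambda>n. l2_norm m (\<lambda>x. \<phi> n x - f x)) \<longlonglongrightarrow> 0" and "f \<in> l2 m"
    using assms by (simp_all only: form_approx_def)
  have "\<phi> n \<in> Cc" for n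
    using assms by (simp only: form_approx_def)
  then show "\<forall>\<^sub>F n in sequentially. \<phi> n \<in> l2 m"
    by (simp add: Cc_subset_l2)
qed

text \<open>Testing against the indicator of a vertex shows that \<open>\<Delta>\<close> acts by the formal Laplacian.\<close>

lemma friedrichs_laplacian_pointwise:
  assumes "friedrichs_laplacian b m f h"
  shows "formal_laplacian b m f x = h x"
proof -
  define \<delta> where "\<delta> = (\<lambda>y. if y = x then 1 else 0 :: real)"
  have \<delta>: "\<delta> \<in> Cc" by (auto simp: \<delta>_def Cc_def)
  have app: "form_approx b m (\<lambda>_. \<delta>) \<delta>"
    using \<delta> Cc_subset_l2[OF \<delta>] by (auto simp: form_approx_def l2_norm_def l2_inner_def energy_def
        case_prod_unfold)
  obtain \<phi> where \<phi>: "form_approx b m \<phi> f"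
    using assms by (auto simp: friedrichs_laplacian_def form_domain_def)
  have E: "energy b g \<delta> = formal_laplacian b m g x * m x" for g
    by (subst energy_Green[of "{x}"]) (auto simp: \<delta>_def)
  have "(\<lambda>n. energy b (\<phi> n) \<delta>) \<longlonglongrightarrow> l2_inner m h \<delta>"
    using assms \<phi> app unfolding friedrichs_laplacian_def has_closed_energy_def form_domain_def
    by blast
  moreover have "(\<lambda>n. energy b (\<phi> n) \<delta>) \<longlonglongrightarrow> formal_laplacian b m f x * m x"
    unfolding E by (intro tendsto_intros tendsto_formal_laplacian form_approx_tendsto[OF \<phi>])
  moreover have "l2_inner m h \<delta> = h x * m x"
  proof -
    have "l2_inner m h \<delta> = (\<Sum>\<^sub>\<infinity>y\<in>{x}. h y * \<delta> y * m y)"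
      unfolding l2_inner_def by (rule infsum_cong_neutral) (auto simp: \<delta>_def)
    then show ?thesis by (simp add: \<delta>_def)
  qed
  ultimately have "formal_laplacian b m f x * m x = h x * m x"
    using LIMSEQ_unique by force
  then show ?thesis using measure_pos[of x] by simp
qed

section \<open>A comparison principle\<close>

text \<open>
  A nonnegative subsolution below \<open>v\<close> is not known in advance to lie in the form domain. If \<open>\<phi>\<close> in
  \<^const>\<open>Cc\<close> is close to \<open>v\<close>, however, then \<open>\<zeta> = max 0 (w - (v - \<phi>))\<close> vanishes wherever
  \<open>\<phi> \<le> 0\<close>, so it is finitely supported and may be used as a test function. This bounds the
  energy norm of \<open>\<zeta>\<close> by that of \<open>v - \<phi>\<close>, and letting \<open>\<phi>\<close> tend to \<open>v\<close> forces \<open>w = 0\<close>.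
\<close>

lemma nonneg_subsolution_eq_0:
  assumes "\<mu> > 0" and v: "v \<in> form_domain b m"
    and w0: "\<And>x. 0 \<le> w x" and wv: "\<And>x. w x \<le> v x"
    and sub: "\<And>x. formal_laplacian b m w x + \<mu> * w x \<le> 0"
  shows "w x = 0"
proof -
  let ?L = "formal_laplacian b m"
  obtain \<phi> where \<phi>: "form_approx b m \<phi> v"
    using v by (auto simp: form_domain_def)
  have \<phi>C: "\<phi> n \<in> Cc" for n using \<phi> by (simp only: form_approx_def)
  note lim = form_approx_tendsto[OF \<phi>]
  define \<zeta> where "\<zeta> k x = max 0 (w x - (v x - \<phi> k x))" for k x
  have \<zeta>C: "\<zeta> k \<in> Cc" for k
  proof -
    have "\<zeta> k x = 0" if "\<phi> k x = 0" for x
      using that wv[of x] by (simp add: \<zeta>_def)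
    then have "{x. \<zeta> k x \<noteq> 0} \<subseteq> {x. \<phi> k x \<noteq> 0}" by auto
    then show ?thesis using \<phi>C[of k] finite_subset by (auto simp: Cc_def)
  qed
  have \<zeta>0: "0 \<le> \<zeta> k x" for k x by (simp add: \<zeta>_def)
  have bound: "\<mu> * (\<zeta> k x)\<^sup>2 * m x \<le> \<epsilon>"
    if "\<forall>\<^sub>F j in sequentially. energy b (\<lambda>x. \<phi> k x - \<phi> j x) (\<lambda>x. \<phi> k x - \<phi> j x)
          + \<mu> * (l2_norm m (\<lambda>x. \<phi> k x - \<phi> j x))\<^sup>2 \<le> \<epsilon>" for k \<epsilon> x
  proof -
    define S where "S = insert x {y. \<zeta> k y \<noteq> 0}"
    have S: "finite S" "\<And>y. y \<notin> S \<Longrightarrow> \<zeta> k y = 0"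
      using \<zeta>C[of k] by (auto simp: S_def Cc_def)
    define B where "B h = (\<Sum>y\<in>S. (?L h y + \<mu> * h y) * \<zeta> k y * m y)" for h
    have B_energy: "B h = energy b h (\<zeta> k) + (\<Sum>y\<in>S. \<mu> * h y * \<zeta> k y * m y)" for h
      by (subst energy_Green[OF S]) (auto simp: B_def algebra_simps sum.distrib)
    \<comment> \<open>Where \<open>\<zeta> k\<close> is positive it coincides with \<open>w - v + \<phi> k\<close>, and it dominates this
      function everywhere.\<close>
    have "B (\<zeta> k) \<le> B (\<lambda>y. \<phi> k y - v y)"
      unfolding B_def
    proof (rule sum_mono)
      fix y
      show "(?L (\<zeta> k) y + \<mu> * \<zeta> k y) * \<zeta> k y * m y
          \<le> (?L (\<lambda>y. \<phi> k y - v y) y + \<mu> * (\<phi> k y - v y)) * \<zeta> k y * m y"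
      proof (cases "\<zeta> k y = 0")
        case False
        then have eq: "\<zeta> k y = w y - (v y - \<phi> k y)"
          by (auto simp: \<zeta>_def max_def split: if_splits)
        have "?L (\<zeta> k) y \<le> ?L (\<lambda>y. w y - (v y - \<phi> k y)) y"
          by (rule formal_laplacian_mono_at) (auto simp: eq, simp add: \<zeta>_def)
        also have "\<dots> = ?L w y + ?L (\<lambda>y. \<phi> k y - v y) y"
          by (simp add: formal_laplacian_diff)
        finally have "?L (\<zeta> k) y + \<mu> * \<zeta> k y
            \<le> ?L (\<lambda>y. \<phi> k y - v y) y + \<mu> * (\<phi> k y - v y)"
          using sub[of y] unfolding eq by (simp add: algebra_simps)
        then show ?thesis by (intro mult_right_mono \<zeta>0 m_nonneg)
      qed simp
    qed
    moreover have "B (\<lambda>y. \<phi> k y - v y) \<le> (\<epsilon> + B (\<zeta> k)) / 2"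
    proof (rule tendsto_upperbound)
      show "((\<lambda>j. B (\<lambda>y. \<phi> k y - \<phi> j y)) \<longlongrightarrow> B (\<lambda>y. \<phi> k y - v y)) sequentially"
        unfolding B_def by (intro tendsto_intros tendsto_formal_laplacian lim)
      show "\<forall>\<^sub>F j in sequentially. B (\<lambda>y. \<phi> k y - \<phi> j y) \<le> (\<epsilon> + B (\<zeta> k)) / 2"
        using that
      proof eventually_elim
        fix j
        let ?d = "\<lambda>y. \<phi> k y - \<phi> j y"
        assume small: "energy b ?d ?d + \<mu> * (l2_norm m ?d)\<^sup>2 \<le> \<epsilon>"
        have dC: "?d \<in> Cc" by (intro Cc_diff \<phi>C)
        have "(\<Sum>y\<in>S. \<mu> * ?d y * \<zeta> k y * m y)
            \<le> (\<Sum>y\<in>S. (\<mu> * ((?d y)\<^sup>2 * m y) + \<mu> * \<zeta> k y * \<zeta> k y * m y) / 2)"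
        proof (rule sum_mono)
          fix y
          have "u * z \<le> (u\<^sup>2 + z * z) / 2" for u z :: real
            using sum_squares_bound[of u z] by (simp add: power2_eq_square)
          then have "?d y * \<zeta> k y \<le> ((?d y)\<^sup>2 + \<zeta> k y * \<zeta> k y) / 2" .
          then have "(\<mu> * m y) * (?d y * \<zeta> k y)
              \<le> (\<mu> * m y) * (((?d y)\<^sup>2 + \<zeta> k y * \<zeta> k y) / 2)"
            using assms(1) m_nonneg[of y] by (intro mult_left_mono) auto
          then show "\<mu> * ?d y * \<zeta> k y * m y
              \<le> (\<mu> * ((?d y)\<^sup>2 * m y) + \<mu> * \<zeta> k y * \<zeta> k y * m y) / 2"
            by (simp add: algebra_simps)
        qed
        also have "\<dots> = (\<mu> * (\<Sum>y\<in>S. (?d y)\<^sup>2 * m y)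
            + (\<Sum>y\<in>S. \<mu> * \<zeta> k y * \<zeta> k y * m y)) / 2"
          by (simp add: sum.distrib sum_distrib_left flip: sum_divide_distrib)
        also have "(\<Sum>y\<in>S. (?d y)\<^sup>2 * m y) \<le> (l2_norm m ?d)\<^sup>2"
          using L2_set_le_l2_norm[OF Cc_subset_l2[OF dC] S(1)]
          unfolding sq_weight_L2_set by (simp add: sqrt_le_D)
        finally have "(\<Sum>y\<in>S. \<mu> * ?d y * \<zeta> k y * m y) \<le> (\<mu> * (l2_norm m ?d)\<^sup>2
            + (\<Sum>y\<in>S. \<mu> * \<zeta> k y * \<zeta> k y * m y)) / 2"
          using assms(1) by simp
        then show "B ?d \<le> (\<epsilon> + B (\<zeta> k)) / 2"
          using energy_le_half_sum[OF dC \<zeta>C[of k]] small unfolding B_energy by simp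
      qed
    qed simp
    ultimately have "B (\<zeta> k) \<le> \<epsilon>" by simp
    then have "(\<Sum>y\<in>S. \<mu> * \<zeta> k y * \<zeta> k y * m y) \<le> \<epsilon>"
      unfolding B_energy using energy_nonneg[of "\<zeta> k"] by simp
    moreover have "\<mu> * \<zeta> k x * \<zeta> k x * m x \<le> (\<Sum>y\<in>S. \<mu> * \<zeta> k y * \<zeta> k y * m y)"
      using S(1) assms(1) m_nonneg \<zeta>0 by (intro member_le_sum) (auto simp: S_def)
    ultimately show ?thesis by (simp add: power2_eq_square)
  qed
  have "\<mu> * (w x)\<^sup>2 * m x \<le> \<epsilon>" if "\<epsilon> > 0" for \<epsilon>
  proof (rule tendsto_upperbound)
    have "(\<lambda>k. \<zeta> k x) \<longlonglongrightarrow> max 0 (w x - (v x - v x))"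
      unfolding \<zeta>_def by (intro tendsto_intros lim)
    then have "(\<lambda>k. \<zeta> k x) \<longlonglongrightarrow> w x" using w0[of x] by simp
    then show "(\<lambda>k. \<mu> * (\<zeta> k x)\<^sup>2 * m x) \<longlonglongrightarrow> \<mu> * (w x)\<^sup>2 * m x"
      by (intro tendsto_intros)
    define e where "e = sqrt (\<epsilon> / (8 * \<mu>))"
    have e: "e > 0" "\<mu> * (e + e)\<^sup>2 \<le> \<epsilon> / 2"
      using that assms(1) by (auto simp: e_def power2_eq_square algebra_simps)
    have "\<exists>N. \<forall>i\<ge>N. \<forall>j\<ge>N. energy b (\<lambda>x. \<phi> i x - \<phi> j x) (\<lambda>x. \<phi> i x - \<phi> j x) < e'"
      if "e' > 0" for e'
      using \<phi> that by (simp only: form_approx_def)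
    from this[of "\<epsilon> / 2"] obtain N1 where N1: "\<And>i j. i \<ge> N1 \<Longrightarrow> j \<ge> N1 \<Longrightarrow>
        energy b (\<lambda>x. \<phi> i x - \<phi> j x) (\<lambda>x. \<phi> i x - \<phi> j x) < \<epsilon> / 2"
      using \<open>\<epsilon> > 0\<close> by (metis half_gt_zero)
    have "(\<lambda>n. l2_norm m (\<lambda>x. \<phi> n x - v x)) \<longlonglongrightarrow> 0" and vl: "v \<in> l2 m"
      using \<phi> by (simp_all only: form_approx_def)
    from order_tendstoD(2)[OF this(1) e(1)]
    obtain N2 where N2: "\<And>n. n \<ge> N2 \<Longrightarrow> l2_norm m (\<lambda>x. \<phi> n x - v x) < e"
      unfolding eventually_sequentially by blast
    have "energy b (\<lambda>x. \<phi> k x - \<phi> j x) (\<lambda>x. \<phi> k x - \<phi> j x)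
          + \<mu> * (l2_norm m (\<lambda>x. \<phi> k x - \<phi> j x))\<^sup>2 \<le> \<epsilon>"
      if "k \<ge> max N1 N2" "j \<ge> max N1 N2" for k j
    proof -
      have "l2_norm m (\<lambda>x. (\<phi> k x - v x) - (\<phi> j x - v x)) \<le> e + e"
        using N2[of k] N2[of j] that
        by (intro order.trans[OF l2_diff(2)] l2_diff(1) Cc_subset_l2[OF \<phi>C] vl) auto
      then have "(l2_norm m (\<lambda>x. \<phi> k x - \<phi> j x))\<^sup>2 \<le> (e + e)\<^sup>2"
        by (intro power_mono l2_norm_nonneg) simp
      then have "\<mu> * (l2_norm m (\<lambda>x. \<phi> k x - \<phi> j x))\<^sup>2 \<le> \<mu> * (e + e)\<^sup>2"
        using assms(1) by (intro mult_left_mono) auto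
      then show ?thesis using N1[of k j] that e(2) by simp
    qed
    then show "\<forall>\<^sub>F k in sequentially. \<mu> * (\<zeta> k x)\<^sup>2 * m x \<le> \<epsilon>"
      by (intro eventually_sequentiallyI[of "max N1 N2"] bound) blast
  qed simp
  then have "\<mu> * (w x)\<^sup>2 * m x \<le> 0" by (rule field_le_epsilon[of _ 0, simplified])
  then show "w x = 0"
    using assms(1) measure_pos[of x] by (simp add: mult_le_0_iff not_le)
qed

text \<open>
  The positive part of a subsolution is again one, which reduces the general case to the preceding
  lemma.
\<close>

lemma subsolution_comparison:
  assumes "\<mu> > 0" and "v \<in> form_domain b m"
    and "\<And>x. w x \<le> v x" and "\<And>x. 0 \<le> v x"
    and sub: "\<And>x. w x > 0 \<Longrightarrow> formal_laplacian b m w x + \<mu> * w x \<le> 0"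
  shows "w x \<le> 0"
proof -
  have "max 0 (w x) = 0"
  proof (rule nonneg_subsolution_eq_0[OF assms(1,2)])
    fix x
    show "formal_laplacian b m (\<lambda>x. max 0 (w x)) x + \<mu> * max 0 (w x) \<le> 0"
    proof (cases "w x > 0")
      case True
      then have "formal_laplacian b m (\<lambda>x. max 0 (w x)) x \<le> formal_laplacian b m w x"
        by (intro formal_laplacian_mono_at) auto
      with sub[OF True] True show ?thesis by simp
    next
      case False
      then have "formal_laplacian b m (\<lambda>x. max 0 (w x)) x \<le> formal_laplacian b m (\<lambda>_. 0) x"
        by (intro formal_laplacian_mono_at) auto
      with False show ?thesis by (simp add: formal_laplacian_const)
    qed
  qed (use assms(3,4) in auto)
  then show ?thesis by simp
qed

end

section \<open>The heat semigroup of a stochastically complete graph\<close>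

lemma has_sum_diff:
  fixes f g :: "'b \<Rightarrow> real"
  assumes "(f has_sum u) A" and "(g has_sum v) A"
  shows "((\<lambda>x. f x - g x) has_sum (u - v)) A"
  using has_sum_add[OF assms(1) has_sum_uminusI[OF assms(2)]] by simp

locale stochastically_complete_semigroup = weighted_graph b m
  for b :: "'a \<Rightarrow> 'a \<Rightarrow> real" and m :: "'a \<Rightarrow> real" +
  fixes p :: "real \<Rightarrow> 'a \<Rightarrow> 'a \<Rightarrow> real" and P :: "real \<Rightarrow> ('a \<Rightarrow> real) \<Rightarrow> 'a \<Rightarrow> real"
  assumes p_nonneg: "0 \<le> t \<Longrightarrow> 0 \<le> p t x y"
    and semigroup: "heat_semigroup b m P"
    and P_has_sum: "0 \<le> t \<Longrightarrow> f \<in> l2 m \<Longrightarrow> ((\<lambda>y. p t x y * f y * m y) has_sum P t f x) UNIV"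
    and p_has_sum_1: "0 \<le> t \<Longrightarrow> ((\<lambda>y. p t x y * m y) has_sum 1) UNIV"
begin

lemma P_l2: "0 \<le> t \<Longrightarrow> f \<in> l2 m \<Longrightarrow> P t f \<in> l2 m"
  and P_lincomb: "0 \<le> t \<Longrightarrow> f \<in> l2 m \<Longrightarrow> g \<in> l2 m
    \<Longrightarrow> P t (\<lambda>x. \<alpha> * f x + \<beta> * g x) = (\<lambda>x. \<alpha> * P t f x + \<beta> * P t g x)"
  and P_bounded: "0 \<le> t \<Longrightarrow> \<exists>C. \<forall>f\<in>l2 m. l2_norm m (P t f) \<le> C * l2_norm m f"
  and P_0: "f \<in> l2 m \<Longrightarrow> P 0 f = f"
  and P_add: "0 \<le> s \<Longrightarrow> 0 \<le> t \<Longrightarrow> f \<in> l2 m \<Longrightarrow> P (s + t) f = P s (P t f)"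
  and P_continuous_at_0:
    "f \<in> l2 m \<Longrightarrow> ((\<lambda>t. l2_norm m (\<lambda>x. P t f x - f x)) \<longlongrightarrow> 0) (at_right 0)"
  and P_generator: "f \<in> l2 m \<Longrightarrow> h \<in> l2 m \<Longrightarrow> friedrichs_laplacian b m f h \<longleftrightarrow>
    ((\<lambda>t. l2_norm m (\<lambda>x. (P t f x - f x) / t - (- h x))) \<longlongrightarrow> 0) (at_right 0)"
  using semigroup unfolding heat_semigroup_def by blast+

lemma P_nonneg:
  assumes "0 \<le> t" and "f \<in> l2 m" and "\<And>x. 0 \<le> f x"
  shows "0 \<le> P t f x"
  using assms by (intro has_sum_nonneg[OF P_has_sum]) (auto simp: p_nonneg m_nonneg)

lemma P_le:
  assumes "0 \<le> t" and "f \<in> l2 m" and "\<And>x. f x \<le> C"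
  shows "P t f x \<le> C"
proof (rule has_sum_mono[OF P_has_sum[OF assms(1,2)]])
  show "((\<lambda>y. C * (p t x y * m y)) has_sum C) UNIV"
    using has_sum_cmult_right[OF p_has_sum_1[OF assms(1)], of C x] by simp
  show "p t x y * f y * m y \<le> C * (p t x y * m y)" for y
    using mult_right_mono[OF assms(3)[of y], of "p t x y * m y"] p_nonneg[OF assms(1)] m_nonneg
    by (simp add: mult.left_commute mult.assoc)
qed

lemma P_abs_le:
  assumes "0 \<le> t" and "f \<in> l2 m" and "\<And>x. \<bar>f x\<bar> \<le> C"
  shows "\<bar>P t f x\<bar> \<le> C"
proof -
  have "P t (\<lambda>x. - 1 * f x + 0 * f x) x \<le> C"
    using assms(3) by (intro P_le assms(1) l2_add l2_scale assms(2)) (simp add: abs_le_iff)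
  moreover have "P t f x \<le> C"
    using assms(3) by (intro P_le assms(1,2)) (simp add: abs_le_iff)
  ultimately show ?thesis
    using P_lincomb[OF assms(1,2,2), of "-1" 0] by simp
qed

definition return_prob :: "'a \<Rightarrow> real \<Rightarrow> real" where
  "return_prob x h = p h x x * m x"

lemma indicator_l2: "(\<lambda>x. if x = y then 1 else 0) \<in> l2 m"
  by (rule Cc_subset_l2) (auto simp: Cc_def)

lemma P_indicator:
  assumes "0 \<le> t"
  shows "P t (\<lambda>x. if x = y then 1 else 0) x = p t x y * m y"
proof -
  have "((\<lambda>z. p t x z * (if z = y then 1 else 0) * m z) has_sum p t x y * m y) UNIV"
    by (rule has_sum_finite_neutralI[of "{y}"]) auto
  with P_has_sum[OF assms indicator_l2] show ?thesis
    by (rule has_sum_unique)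
qed

lemma tendsto_return_prob: "(return_prob x \<longlongrightarrow> 1) (at_right 0)"
proof -
  let ?\<delta> = "\<lambda>z. if z = x then 1 else 0 :: real"
  have "((\<lambda>t. P t ?\<delta> x) \<longlongrightarrow> ?\<delta> x) (at_right 0)"
  proof (rule tendsto_pointwise_if_l2[OF P_continuous_at_0[OF indicator_l2] _ indicator_l2])
    show "\<forall>\<^sub>F t in at_right 0. P t ?\<delta> \<in> l2 m"
      using eventually_at_right_less[of "0::real"]
      by (rule eventually_mono) (simp add: P_l2 indicator_l2)
  qed
  moreover have "\<forall>\<^sub>F t in at_right 0. P t ?\<delta> x = return_prob x t"
    using eventually_at_right_less[of "0::real"]
    by (rule eventually_mono) (simp add: P_indicator return_prob_def)
  ultimately show ?thesis by (simp add: filterlim_cong)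
qed

lemma return_prob_times_p_le:
  assumes "0 \<le> s" and "0 \<le> h"
  shows "return_prob x h * p s x y \<le> p (s + h) x y"
proof -
  let ?\<delta> = "\<lambda>z. if z = y then 1 else 0 :: real"
  note \<delta> = indicator_l2[of y]
  have "((\<lambda>z. p h x z * P s ?\<delta> z * m z) has_sum P h (P s ?\<delta>) x) UNIV"
    by (intro P_has_sum P_l2 \<delta> assms)
  then have "(\<Sum>z\<in>{x}. p h x z * P s ?\<delta> z * m z) \<le> P h (P s ?\<delta>) x"
    using assms by (intro finite_sum_le_has_sum) (auto simp: p_nonneg m_nonneg P_indicator)
  then have "(return_prob x h * p s x y) * m y \<le> p (h + s) x y * m y"
    using assms P_add[OF assms(2,1) \<delta>, symmetric]
    by (simp add: P_indicator return_prob_def algebra_simps)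
  then show ?thesis
    using measure_pos[of y] by (simp add: mult_le_cancel_right add.commute)
qed

text \<open>
  The flow started at \<open>x\<close> may be at \<open>x\<close> again after time \<open>h\<close>, so \<open>p (s + h) x\<close> dominates
  \<open>p s x\<close> up to the factor \<open>return_prob x h\<close>, which is close to 1. As both are probability
  densities, they must be close in \<open>\<ell>\<^sup>1\<close> (Scheffe's lemma). The estimate is uniform in
  \<open>s\<close>, so it gives continuity in time from the left as well as from the right.
\<close>

lemma P_time_modulus:
  assumes "0 \<le> s" and "0 \<le> h" and g: "g \<in> l2 m" "\<And>x. \<bar>g x\<bar> \<le> C" and pos: "return_prob x h > 0"
  shows "\<bar>P (s + h) g x - P s g x\<bar> \<le> 2 * C * (1 / return_prob x h - 1)"
proof -
  define c where "c = 1 / return_prob x h"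
  have dom: "p s x y \<le> c * p (s + h) x y" for y
    using return_prob_times_p_le[OF assms(1,2), of x y] pos by (simp add: c_def field_simps)
  have C0: "0 \<le> C" using g(2)[of x] by linarith
  have sum_c: "((\<lambda>y. c * (p (s + h) x y * m y) - p s x y * m y) has_sum c * 1 - 1) UNIV"
    using assms by (intro has_sum_diff has_sum_cmult_right p_has_sum_1) auto
  have sum_g: "((\<lambda>y. c * (p (s + h) x y * g y * m y) - p s x y * g y * m y)
      has_sum c * P (s + h) g x - P s g x) UNIV"
    using assms by (intro has_sum_diff has_sum_cmult_right P_has_sum) auto
  have le: "\<bar>c * (p (s + h) x y * g y * m y) - p s x y * g y * m y\<bar>
      \<le> C * (c * (p (s + h) x y * m y) - p s x y * m y)" for y
  proof -
    have nn: "0 \<le> (c * p (s + h) x y - p s x y) * m y"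
      using dom[of y] m_nonneg by simp
    have "\<bar>c * (p (s + h) x y * g y * m y) - p s x y * g y * m y\<bar>
        = \<bar>g y * ((c * p (s + h) x y - p s x y) * m y)\<bar>"
      by (simp add: algebra_simps)
    also have "\<dots> = \<bar>g y\<bar> * ((c * p (s + h) x y - p s x y) * m y)"
      by (simp only: abs_mult[of "g y"] abs_of_nonneg[OF nn])
    also have "\<dots> \<le> C * ((c * p (s + h) x y - p s x y) * m y)"
      by (intro mult_right_mono g(2) nn)
    finally show ?thesis by (simp add: algebra_simps)
  qed
  have "c * P (s + h) g x - P s g x \<le> C * (c * 1 - 1)"
    using le by (intro has_sum_mono[OF sum_g has_sum_cmult_right[OF sum_c]]) (simp add: abs_le_iff)
  moreover have "- C * (c * 1 - 1) \<le> c * P (s + h) g x - P s g x"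
  proof (rule has_sum_mono[OF has_sum_cmult_right[OF sum_c] sum_g])
    show "- C * (c * (p (s + h) x y * m y) - p s x y * m y)
        \<le> c * (p (s + h) x y * g y * m y) - p s x y * g y * m y" for y
      using le[of y] by (simp only: abs_le_iff) linarith
  qed
  ultimately have 1: "\<bar>c * P (s + h) g x - P s g x\<bar> \<le> C * (c - 1)" by simp
  have "0 \<le> c - 1"
    using has_sum_nonneg[OF sum_c] dom m_nonneg
    by (simp add: mult_right_mono flip: mult.assoc)
  moreover have "\<bar>P (s + h) g x\<bar> \<le> C"
    using assms by (intro P_abs_le) auto
  ultimately have 2: "\<bar>(c - 1) * P (s + h) g x\<bar> \<le> C * (c - 1)"
    using mult_left_mono[of "\<bar>P (s + h) g x\<bar>" C "c - 1"] by (simp add: abs_mult mult.commute)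
  from 1 2 show ?thesis
    unfolding c_def[symmetric] by (simp add: algebra_simps abs_le_iff)
qed

lemma continuous_on_P:
  assumes g: "g \<in> l2 m" "\<And>x. \<bar>g x\<bar> \<le> C"
  shows "continuous_on {0..} (\<lambda>t. P t g x)"
proof -
  have "((\<lambda>h. 2 * C * (1 / return_prob x h - 1)) \<longlongrightarrow> 2 * C * (1 / 1 - 1)) (at_right 0)"
    by (intro tendsto_intros tendsto_return_prob) auto
  then have lim: "((\<lambda>h. 2 * C * (1 / return_prob x h - 1)) \<longlongrightarrow> 0) (at_right 0)" by simp
  show ?thesis
    unfolding continuous_on_iff
  proof (intro ballI allI impI)
    fix s e :: real assume "s \<in> {0..}" "0 < e"
    have "\<forall>\<^sub>F h in at_right 0. 2 * C * (1 / return_prob x h - 1) < e \<and> 0 < return_prob x h"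
      using order_tendstoD(2)[OF lim \<open>0 < e\<close>] order_tendstoD(1)[OF tendsto_return_prob, of 0 x]
      by (auto intro: eventually_conj)
    then obtain d where d: "d > 0" "\<And>h. 0 < h \<Longrightarrow> h < d \<Longrightarrow>
        2 * C * (1 / return_prob x h - 1) < e \<and> 0 < return_prob x h"
      unfolding eventually_at_right_field by auto
    have step: "\<bar>P v g x - P u g x\<bar> < e" if "0 \<le> u" "u < v" "v < u + d" for u v
      using P_time_modulus[of u "v - u" g C x] d(2)[of "v - u"] that g by auto
    have "dist (P t g x) (P s g x) < e" if "0 \<le> t" "dist t s < d" for t
      using step[of s t] step[of t s] that \<open>s \<in> {0..}\<close> \<open>0 < e\<close>
      by (cases t s rule: linorder_cases) (auto simp: dist_real_def abs_minus_commute)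
    then show "\<exists>d>0. \<forall>t\<in>{0..}. dist t s < d \<longrightarrow> dist (P t g x) (P s g x) < e"
      using d(1) by auto
  qed
qed

text \<open>
  For a fixed \<open>g\<close>, strong continuity bounds \<open>P t g\<close> on a short interval, and finitely many steps
  of the semigroup, each a bounded operator, carry the bound up to \<open>T\<close>.
\<close>

lemma P_locally_bounded:
  assumes g: "g \<in> l2 m"
  shows "\<exists>B\<ge>0. \<forall>t\<in>{0..T}. l2_norm m (P t g) \<le> B"
proof -
  from order_tendstoD(2)[OF P_continuous_at_0[OF g], of 1]
  obtain d where d: "d > 0" "\<And>t. 0 < t \<Longrightarrow> t < d \<Longrightarrow> l2_norm m (\<lambda>x. P t g x - g x) < 1"
    unfolding eventually_at_right_field by auto
  have base: "l2_norm m (P t g) \<le> 1 + l2_norm m g" if "0 \<le> t" "t < d" for t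
  proof (cases "t = 0")
    case True then show ?thesis by (simp add: P_0 g)
  next
    case False
    have "l2_norm m (\<lambda>x. (P t g x - g x) + g x) \<le> l2_norm m (\<lambda>x. P t g x - g x) + l2_norm m g"
      by (intro l2_add l2_diff P_l2 g that)
    then show ?thesis using d(2)[of t] that False by simp
  qed
  have "\<exists>B\<ge>0. \<forall>t\<in>{0..<real n * (d / 2) + d}. l2_norm m (P t g) \<le> B" for n
  proof (induction n)
    case 0
    show ?case using base l2_norm_nonneg[of g] by (intro exI[of _ "1 + l2_norm m g"]) auto
  next
    case (Suc n)
    then obtain B where B: "B \<ge> 0"
      "\<And>t. 0 \<le> t \<Longrightarrow> t < real n * (d / 2) + d \<Longrightarrow> l2_norm m (P t g) \<le> B" by auto
    obtain C where C: "\<And>f. f \<in> l2 m \<Longrightarrow> l2_norm m (P (d / 2) f) \<le> C * l2_norm m f"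
      using P_bounded[of "d / 2"] d(1) by auto
    have "l2_norm m (P t g) \<le> max B (\<bar>C\<bar> * B)" if "0 \<le> t" "t < real (Suc n) * (d / 2) + d" for t
    proof (cases "t < d / 2")
      case True
      have "0 \<le> real n * (d / 2)" using d(1) by simp
      with True that d(1) have "t < real n * (d / 2) + d" by linarith
      then show ?thesis using B(2)[of t] that by simp
    next
      case False
      then have "l2_norm m (P (d / 2 + (t - d / 2)) g) \<le> C * l2_norm m (P (t - d / 2) g)"
        using d(1) by (subst P_add) (auto intro!: C P_l2 g)
      also have "\<dots> \<le> \<bar>C\<bar> * B"
      proof (intro mult_mono)
        have "t - d / 2 < real n * (d / 2) + d"
          using that(2) d(1) unfolding of_nat_Suc distrib_right by linarith
        then show "l2_norm m (P (t - d / 2) g) \<le> B"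
          using B(2)[of "t - d / 2"] False by simp
      qed (auto simp: l2_norm_nonneg)
      finally show ?thesis by simp
    qed
    then show ?case using B(1) by (intro exI[of _ "max B (\<bar>C\<bar> * B)"]) auto
  qed
  moreover obtain n where "T < real n * (d / 2)"
    using reals_Archimedean3[of "d / 2"] d(1) by auto
  ultimately obtain B where "B \<ge> 0" "\<forall>t\<in>{0..<real n * (d / 2) + d}. l2_norm m (P t g) \<le> B"
    by blast
  with \<open>T < _\<close> d(1) show ?thesis by (intro exI[of _ B]) auto
qed

section \<open>Truncated resolvents\<close>

lemma integrable_discounted:
  assumes "g \<in> l2 m" and "\<And>x. \<bar>g x\<bar> \<le> C" and "0 \<le> c"
  shows "(\<lambda>t. exp (- \<mu> * t) * P t g x) integrable_on {c..d}"
    and "continuous_on {c..d} (\<lambda>t. exp (- \<mu> * t) * P t g x)"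
proof -
  show "continuous_on {c..d} (\<lambda>t. exp (- \<mu> * t) * P t g x)"
    using assms(3)
    by (intro continuous_intros continuous_on_subset[OF continuous_on_P[OF assms(1,2)]]) auto
  then show "(\<lambda>t. exp (- \<mu> * t) * P t g x) integrable_on {c..d}"
    by (rule integrable_continuous_interval)
qed

text \<open>
  The truncated resolvent \<open>\<integral>\<^sub>c\<^sup>d e\<^sup>-\<^sup>\<mu>\<^sup>t P\<^sub>t g dt\<close>, taken vertexwise. For \<open>\<mu> > 0\<close>,
  \<open>c = 0\<close> and \<open>d \<rightarrow> \<infinity>\<close> it tends to \<open>(\<Delta> + \<mu>)\<^sup>-\<^sup>1 g\<close>; a finite \<open>d\<close> keeps every estimate
  elementary and costs only an exponentially small error.
\<close>

definition discounted :: "real \<Rightarrow> ('a \<Rightarrow> real) \<Rightarrow> real \<Rightarrow> real \<Rightarrow> 'a \<Rightarrow> real" where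
  "discounted \<mu> g c d x = integral {c..d} (\<lambda>t. exp (- \<mu> * t) * P t g x)"

text \<open>
  The semigroup may be taken under the integral sign: since \<open>p\<^sub>s(x, \<cdot>)\<close> is a probability density
  and \<open>g\<close> is bounded, the sum over \<open>y\<close> converges uniformly in \<open>t\<close>.
\<close>

lemma P_discounted:
  assumes g: "g \<in> l2 m" "\<And>x. \<bar>g x\<bar> \<le> C" and "0 \<le> c" "c \<le> d" "0 \<le> s"
    and l2: "discounted \<mu> g c d \<in> l2 m"
  shows "P s (discounted \<mu> g c d) x = exp (\<mu> * s) * discounted \<mu> g (c + s) (d + s) x"
proof -
  let ?U = "discounted \<mu> g c d"
  let ?J = "\<lambda>t. exp (- \<mu> * t) * P (s + t) g x"
  define K where "K = C * exp (\<bar>\<mu>\<bar> * d)"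
  have C0: "0 \<le> C" using g(2)[of x] by linarith
  have cont: "continuous_on {c..d} ?J"
  proof (intro continuous_intros)
    have "continuous_on {c..d} ((\<lambda>t. P t g x) \<circ> (\<lambda>t. s + t))"
      using assms by (intro continuous_on_compose continuous_intros
          continuous_on_subset[OF continuous_on_P[OF g]]) auto
    then show "continuous_on {c..d} (\<lambda>t. P (s + t) g x)" by (simp add: o_def)
  qed
  have J: "(?J has_integral integral {c..d} ?J) {c..d}"
    by (intro integrable_integral integrable_continuous_interval cont)
  have discount_le: "exp (- \<mu> * t) * C \<le> K" if "t \<in> {c..d}" for t
  proof -
    have "- \<mu> * t \<le> \<bar>\<mu>\<bar> * t"
      using that assms(3) by (intro mult_right_mono) auto
    also have "\<dots> \<le> \<bar>\<mu>\<bar> * d" using that by (intro mult_left_mono) auto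
    finally show ?thesis using C0 by (simp add: K_def mult.commute mult_left_mono)
  qed
  have bound: "norm ((\<Sum>y\<in>F. p s x y * ?U y * m y) - integral {c..d} ?J)
      \<le> (d - c) * K * (1 - (\<Sum>y\<in>F. p s x y * m y))" if F: "finite F" for F
  proof -
    let ?D = "\<lambda>t. (\<Sum>y\<in>F. p s x y * (exp (- \<mu> * t) * P t g y) * m y) - ?J t"
    define r where "r = 1 - (\<Sum>y\<in>F. p s x y * m y)"
    have r: "((\<lambda>y. p s x y * m y) has_sum r) (- F)"
    proof -
      have "((\<lambda>y. p s x y * m y) has_sum r) (UNIV - F)"
        unfolding r_def using F assms by (intro has_sum_Diff p_has_sum_1 has_sum_finite) auto
      then show ?thesis by (simp add: Compl_eq_Diff_UNIV)
    qed
    have r0: "0 \<le> r"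
      by (rule has_sum_nonneg[OF r]) (simp add: p_nonneg m_nonneg assms)
    have "(?D has_integral (\<Sum>y\<in>F. p s x y * ?U y * m y) - integral {c..d} ?J) {c..d}"
      unfolding discounted_def
      by (intro has_integral_diff has_integral_sum F has_integral_mult_left has_integral_mult_right
          J integrable_integral integrable_discounted(1)[OF g] assms)
    moreover have "norm (?D t) \<le> K * r" if t: "t \<in> {c..d}" for t
    proof -
      have t0: "0 \<le> t" using t assms by auto
      have "((\<lambda>y. p s x y * P t g y * m y) has_sum P (s + t) g x) UNIV"
        using P_has_sum[OF assms(5) P_l2[OF t0 g(1)], of x] P_add[OF assms(5) t0 g(1)] by simp
      then have "((\<lambda>y. p s x y * P t g y * m y) has_sum
          P (s + t) g x - (\<Sum>y\<in>F. p s x y * P t g y * m y)) (UNIV - F)"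
        using F by (intro has_sum_Diff has_sum_finite) auto
      then have tail: "((\<lambda>y. p s x y * P t g y * m y) has_sum
          P (s + t) g x - (\<Sum>y\<in>F. p s x y * P t g y * m y)) (- F)"
        by (simp add: Compl_eq_Diff_UNIV)
      have le: "\<bar>p s x y * P t g y * m y\<bar> \<le> C * (p s x y * m y)" for y
        using mult_right_mono[OF P_abs_le[OF t0 g, of y], of "p s x y * m y"]
          p_nonneg[OF assms(5), of x y] m_nonneg[of y]
        by (simp add: abs_mult algebra_simps)
      have "P (s + t) g x - (\<Sum>y\<in>F. p s x y * P t g y * m y) \<le> C * r"
        using le by (intro has_sum_mono[OF tail has_sum_cmult_right[OF r]]) (simp add: abs_le_iff)
      moreover have "- C * r \<le> P (s + t) g x - (\<Sum>y\<in>F. p s x y * P t g y * m y)"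
        using le by (intro has_sum_mono[OF has_sum_cmult_right[OF r] tail])
          (simp add: abs_le_iff minus_le_iff)
      ultimately have P_close: "\<bar>(\<Sum>y\<in>F. p s x y * P t g y * m y) - P (s + t) g x\<bar> \<le> C * r"
        by (simp add: abs_le_iff)
      have D_eq: "?D t = exp (- \<mu> * t) * ((\<Sum>y\<in>F. p s x y * P t g y * m y) - P (s + t) g x)"
        unfolding right_diff_distrib sum_distrib_left by (simp add: mult_ac)
      have "exp (- \<mu> * t) * \<bar>(\<Sum>y\<in>F. p s x y * P t g y * m y) - P (s + t) g x\<bar>
          \<le> exp (- \<mu> * t) * C * r"
        using P_close by (simp add: mult.assoc)
      also have "\<dots> \<le> K * r"
        by (intro mult_right_mono discount_le t r0)
      finally show ?thesis
        unfolding D_eq real_norm_def abs_mult abs_exp_cancel .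
    qed
    ultimately have "norm ((\<Sum>y\<in>F. p s x y * ?U y * m y) - integral {c..d} ?J)
        \<le> (K * r) * measure lborel {c..d}"
      using r0 C0 by (intro has_integral_bound_real[of "K * r" "{}" ?D]) (auto simp: K_def)
    then show ?thesis using assms(4) by (simp add: r_def mult_ac)
  qed
  have "((\<lambda>F. (d - c) * K * (1 - (\<Sum>y\<in>F. p s x y * m y))) \<longlongrightarrow> (d - c) * K * (1 - 1))
      (finite_subsets_at_top UNIV)"
    using p_has_sum_1[OF assms(5), of x] unfolding has_sum_def by (intro tendsto_intros)
  then have "((\<lambda>F. (d - c) * K * (1 - (\<Sum>y\<in>F. p s x y * m y))) \<longlongrightarrow> 0)
      (finite_subsets_at_top UNIV)"
    by simp
  then have "((\<lambda>F. (\<Sum>y\<in>F. p s x y * ?U y * m y) - integral {c..d} ?J) \<longlongrightarrow> 0)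
      (finite_subsets_at_top UNIV)"
    by (rule Lim_null_comparison[rotated])
      (intro eventually_finite_subsets_at_top_weakI bound, simp)
  then have "((\<lambda>y. p s x y * ?U y * m y) has_sum integral {c..d} ?J) UNIV"
    by (simp add: has_sum_def LIM_zero_iff)
  then have "P s ?U x = integral {c..d} ?J"
    using P_has_sum[OF assms(5) l2] has_sum_unique by blast
  also have "\<dots> = integral {c + s..d + s} (\<lambda>t. exp (\<mu> * s) * (exp (- \<mu> * t) * P t g x))"
  proof -
    have "((\<lambda>t. exp (\<mu> * s) * (exp (- \<mu> * (s + t)) * P (s + t) g x))
        has_integral integral {c..d} ?J) {c..d}"
    proof -
      have "exp (\<mu> * s) * exp (- \<mu> * (s + t)) = exp (- \<mu> * t)" for t
        unfolding mult_exp_exp by (simp add: algebra_simps)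
      then have "?J = (\<lambda>t. exp (\<mu> * s) * (exp (- \<mu> * (s + t)) * P (s + t) g x))"
        by (simp only: mult.assoc[symmetric])
      with J show ?thesis by simp
    qed
    then have "((\<lambda>t. exp (\<mu> * s) * (exp (- \<mu> * t) * P t g x))
        has_integral integral {c..d} ?J) {c + s..d + s}"
      using has_integral_shift_Icc_real
        [of "\<lambda>t. exp (\<mu> * s) * (exp (- \<mu> * t) * P t g x)" s _ c d]
      by (simp add: o_def add.commute)
    then show ?thesis by (rule integral_unique[symmetric])
  qed
  also have "\<dots> = exp (\<mu> * s) * discounted \<mu> g (c + s) (d + s) x"
    by (simp add: discounted_def)
  finally show ?thesis .
qed

lemma discounted_l2:
  assumes g: "g \<in> l2 m" "\<And>x. \<bar>g x\<bar> \<le> C" and "0 \<le> c" "c \<le> d"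
  shows "discounted \<mu> g c d \<in> l2 m"
proof -
  obtain B where B: "B \<ge> 0" "\<And>t. t \<in> {0..d} \<Longrightarrow> l2_norm m (P t g) \<le> B"
    using P_locally_bounded[OF g(1), of d] by blast
  show ?thesis
    unfolding discounted_def
  proof (rule l2_integral(1))
    fix t assume t: "t \<in> {c..d}"
    then show "(\<lambda>x. exp (- \<mu> * t) * P t g x) \<in> l2 m"
      using assms by (intro l2_scale P_l2) auto
    have "l2_norm m (\<lambda>x. exp (- \<mu> * t) * P t g x) \<le> \<bar>exp (- \<mu> * t)\<bar> * l2_norm m (P t g)"
      using t assms by (intro l2_scale P_l2) auto
    also have "\<dots> \<le> exp (\<bar>\<mu>\<bar> * d) * B"
    proof -
      have "- \<mu> * t \<le> \<bar>\<mu>\<bar> * t"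
        using t assms(3) by (intro mult_right_mono) auto
      also have "\<dots> \<le> \<bar>\<mu>\<bar> * d" using t by (intro mult_left_mono) auto
      finally show ?thesis
        using t assms(3) B by (intro mult_mono l2_norm_nonneg) auto
    qed
    finally show "l2_norm m (\<lambda>x. exp (- \<mu> * t) * P t g x) \<le> exp (\<bar>\<mu>\<bar> * d) * B" .
  qed (use assms B integrable_discounted(2)[OF g] in auto)
qed

lemma discounted_nonneg:
  assumes "g \<in> l2 m" "\<And>x. \<bar>g x\<bar> \<le> C" and "0 \<le> c" "\<And>x. 0 \<le> g x"
  shows "0 \<le> discounted \<mu> g c d x"
  unfolding discounted_def using assms
  by (intro integral_nonneg integrable_discounted(1)[OF assms(1,2)] mult_nonneg_nonneg P_nonneg) auto

text \<open>
  The average over a short interval starting at 0 recovers \<open>g\<close>. The factor \<open>e\<^sup>\<mu>\<^sup>h\<close>, which tends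
  to 1, is the one with which this average enters the difference quotient of the semigroup.
\<close>

lemma discounted_average_tendsto:
  assumes g: "g \<in> l2 m" "\<And>x. \<bar>g x\<bar> \<le> C"
  shows "((\<lambda>h. l2_norm m (\<lambda>x. exp (\<mu> * h) * (discounted \<mu> g 0 h x / h) - g x)) \<longlongrightarrow> 0) (at_right 0)"
proof (rule tendstoI)
  fix e :: real assume "e > 0"
  define N where "N = l2_norm m g"
  have N0: "0 \<le> N" by (simp add: N_def l2_norm_nonneg)
  \<comment> \<open>The norm of the integrand below is at most \<open>\<eta> (2 + N) = e / 2\<close>.\<close>
  define \<eta> where "\<eta> = e / 2 / (2 + N)"
  have "2 + N \<noteq> 0" using N0 by simp
  then have "\<eta> * (2 + N) = e / 2"
    using \<eta>_def by (rule iffD1[OF nonzero_eq_divide_eq])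
  then have \<eta>: "0 < \<eta>" "2 * \<eta> + \<eta> * N < e"
    using \<open>e > 0\<close> N0 by (simp add: \<eta>_def, simp add: distrib_left)
  have "((\<lambda>h. exp (\<bar>\<mu>\<bar> * h)) \<longlongrightarrow> exp (\<bar>\<mu>\<bar> * 0)) (at_right 0)"
    by (intro tendsto_intros)
  then have "((\<lambda>h. exp (\<bar>\<mu>\<bar> * h)) \<longlongrightarrow> 1) (at_right 0)" by simp
  then have "\<forall>\<^sub>F h in at_right 0. exp (\<bar>\<mu>\<bar> * h) < 1 + min 1 \<eta>"
    by (rule order_tendstoD) (use \<eta> in auto)
  moreover have "\<forall>\<^sub>F h in at_right 0. l2_norm m (\<lambda>x. P h g x - g x) < \<eta>"
    by (rule order_tendstoD[OF P_continuous_at_0[OF g(1)]]) (use \<eta> in auto)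
  ultimately have "\<forall>\<^sub>F h in at_right 0. exp (\<bar>\<mu>\<bar> * h) < 1 + min 1 \<eta> \<and>
      l2_norm m (\<lambda>x. P h g x - g x) < \<eta>" by (rule eventually_conj)
  then obtain d where d: "d > 0" "\<And>h. 0 < h \<Longrightarrow> h < d \<Longrightarrow> exp (\<bar>\<mu>\<bar> * h) < 1 + min 1 \<eta>"
    "\<And>h. 0 < h \<Longrightarrow> h < d \<Longrightarrow> l2_norm m (\<lambda>x. P h g x - g x) < \<eta>"
    unfolding eventually_at_right_field by auto
  have "l2_norm m (\<lambda>x. exp (\<mu> * h) * (discounted \<mu> g 0 h x / h) - g x) < e"
    if h: "0 < h" "h < d" for h
  proof -
    define \<psi> where "\<psi> t x = exp (\<mu> * (h - t)) * (P t g x - g x) + (exp (\<mu> * (h - t)) - 1) * g x"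
      for t x
    have \<psi>: "\<psi> t x = exp (\<mu> * h) * (exp (- \<mu> * t) * P t g x) - g x" for t x
      by (simp add: \<psi>_def algebra_simps flip: exp_add)
    have \<psi>_l2: "\<psi> t \<in> l2 m" if "t \<in> {0..h}" for t
      unfolding \<psi>_def using that by (intro l2_add l2_scale l2_diff P_l2 g) auto
    have \<psi>_norm: "l2_norm m (\<psi> t) \<le> 2 * \<eta> + \<eta> * N" if t: "t \<in> {0..h}" for t
    proof -
      have lo: "exp (\<mu> * (h - t)) \<le> exp (\<bar>\<mu>\<bar> * h)" and up: "exp (- (\<bar>\<mu>\<bar> * h)) \<le> exp (\<mu> * (h - t))"
      proof -
        have "\<bar>\<mu> * (h - t)\<bar> \<le> \<bar>\<mu>\<bar> * h"
          unfolding abs_mult using t by (intro mult_left_mono) auto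
        then show "exp (\<mu> * (h - t)) \<le> exp (\<bar>\<mu>\<bar> * h)" "exp (- (\<bar>\<mu>\<bar> * h)) \<le> exp (\<mu> * (h - t))"
          by (auto simp: abs_le_iff)
      qed
      have E: "exp (\<bar>\<mu>\<bar> * h) < 1 + min 1 \<eta>" using d(2) h by simp
      have "1 - exp (- (\<bar>\<mu>\<bar> * h)) \<le> exp (\<bar>\<mu>\<bar> * h) - 1"
        using exp_ge_add_one_self[of "\<bar>\<mu>\<bar> * h"] exp_ge_add_one_self[of "- (\<bar>\<mu>\<bar> * h)"] by linarith
      then have diff: "\<bar>exp (\<mu> * (h - t)) - 1\<bar> \<le> \<eta>"
        using lo up E by linarith
      have le2: "\<bar>exp (\<mu> * (h - t))\<bar> \<le> 2"
        unfolding abs_exp_cancel using lo E min.cobounded1[of 1 \<eta>] by linarith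
      have "l2_norm m (\<lambda>x. P t g x - g x) \<le> \<eta>"
        using d(3)[of t] t h \<eta> by (cases "t = 0") (auto simp: P_0 g l2_norm_eq)
      then have "l2_norm m (\<lambda>x. exp (\<mu> * (h - t)) * (P t g x - g x)) \<le> 2 * \<eta>"
        using t le2 \<eta>(1) by (intro order.trans[OF l2_scale(2)] mult_mono l2_diff P_l2 g l2_norm_nonneg) auto
      moreover have "l2_norm m (\<lambda>x. (exp (\<mu> * (h - t)) - 1) * g x) \<le> \<eta> * N"
        using diff N0 unfolding N_def
        by (intro order.trans[OF l2_scale(2)] mult_right_mono g) auto
      ultimately show ?thesis
        unfolding \<psi>_def using t
        by (intro order.trans[OF l2_add(2)] add_mono l2_scale l2_diff P_l2 g) auto
    qed
    have cont: "continuous_on {0..h} (\<lambda>t. \<psi> t x)" for x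
      unfolding \<psi> by (intro continuous_intros integrable_discounted(2)[OF g]) auto
    have eq: "(\<lambda>x. exp (\<mu> * h) * (discounted \<mu> g 0 h x / h) - g x)
        = (\<lambda>x. 1 / h * integral {0..h} (\<lambda>t. \<psi> t x))"
    proof
      fix x
      have "((\<lambda>t. \<psi> t x) has_integral exp (\<mu> * h) * discounted \<mu> g 0 h x - g x * h) {0..h}"
        unfolding \<psi> discounted_def
        using has_integral_const_real[of "g x" 0 h] h
        by (intro has_integral_diff has_integral_mult_right integrable_integral
            integrable_discounted(1)[OF g]) (auto simp: mult.commute)
      from integral_unique[OF this]
      show "exp (\<mu> * h) * (discounted \<mu> g 0 h x / h) - g x = 1 / h * integral {0..h} (\<lambda>t. \<psi> t x)"
        using h by (simp add: field_simps)
    qed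
    have n1: "l2_norm m (\<lambda>x. 1 / h * integral {0..h} (\<lambda>t. \<psi> t x))
        \<le> \<bar>1 / h\<bar> * l2_norm m (\<lambda>x. integral {0..h} (\<lambda>t. \<psi> t x))"
      using h \<eta> N0 \<psi>_l2 \<psi>_norm cont
      by (intro l2_scale l2_integral(1)[where B = "2 * \<eta> + \<eta> * N"]) auto
    have n2: "l2_norm m (\<lambda>x. integral {0..h} (\<lambda>t. \<psi> t x)) \<le> (h - 0) * (2 * \<eta> + \<eta> * N)"
      using h \<eta> N0 \<psi>_l2 \<psi>_norm cont by (intro l2_integral(2)) auto
    have "l2_norm m (\<lambda>x. exp (\<mu> * h) * (discounted \<mu> g 0 h x / h) - g x)
        \<le> \<bar>1 / h\<bar> * ((h - 0) * (2 * \<eta> + \<eta> * N))"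
      unfolding eq by (rule order.trans[OF n1 mult_left_mono[OF n2 abs_ge_zero]])
    also have "\<dots> = 2 * \<eta> + \<eta> * N" using h by simp
    also have "\<dots> < e" by (rule \<eta>(2))
    finally show ?thesis .
  qed
  then show "\<forall>\<^sub>F h in at_right 0.
      dist (l2_norm m (\<lambda>x. exp (\<mu> * h) * (discounted \<mu> g 0 h x / h) - g x)) 0 < e"
    using d(1) l2_norm_nonneg by (auto simp: eventually_at_right_field)
qed

text \<open>
  The generator is tested directly. Splitting the shifted interval \<open>{h..T + h}\<close> gives, with
  \<open>V h = e\<^sup>\<mu>\<^sup>h h\<^sup>-\<^sup>1 \<integral>\<^sub>0\<^sup>h e\<^sup>-\<^sup>\<mu>\<^sup>t P\<^sub>t g dt\<close>,
  \<open>(P\<^sub>h U - U) / h = (e\<^sup>\<mu>\<^sup>h - 1) / h \<cdot> U - V h + e\<^sup>-\<^sup>\<mu>\<^sup>T P\<^sub>T (V h)\<close>, and \<open>V h \<rightarrow> g\<close>.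
\<close>

lemma friedrichs_laplacian_discounted:
  assumes g: "g \<in> l2 m" "\<And>x. \<bar>g x\<bar> \<le> C" and T: "0 \<le> T"
  shows "friedrichs_laplacian b m (discounted \<mu> g 0 T)
    (\<lambda>x. g x - exp (- \<mu> * T) * P T g x - \<mu> * discounted \<mu> g 0 T x)"
proof -
  let ?U = "discounted \<mu> g 0 T"
  let ?h = "\<lambda>x. g x - exp (- \<mu> * T) * P T g x - \<mu> * ?U x"
  have U: "?U \<in> l2 m" by (rule discounted_l2[OF g]) (use T in auto)
  have hl2: "?h \<in> l2 m"
    by (intro l2_diff l2_scale P_l2 g U T)
  define W where "W h x = exp (\<mu> * h) * (discounted \<mu> g 0 h x / h) - g x" for h x
  have W_l2: "W h \<in> l2 m" if "h > 0" for h
  proof -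
    have "discounted \<mu> g 0 h \<in> l2 m"
      by (rule discounted_l2[OF g]) (use that in auto)
    then have "(\<lambda>x. exp (\<mu> * h) / h * discounted \<mu> g 0 h x - g x) \<in> l2 m"
      by (intro l2_diff l2_scale g)
    moreover have "W h = (\<lambda>x. exp (\<mu> * h) / h * discounted \<mu> g 0 h x - g x)"
      by (simp add: W_def fun_eq_iff)
    ultimately show ?thesis by simp
  qed
  have key: "(P h ?U x - ?U x) / h - (- ?h x)
      = ((exp (\<mu> * h) - 1) / h - \<mu>) * ?U x + (- 1 * W h x + exp (- \<mu> * T) * P T (W h) x)"
    if h: "h > 0" for h x
  proof -
    let ?V = "discounted \<mu> g 0 h"
    have V: "?V \<in> l2 m" by (rule discounted_l2[OF g]) (use h in auto)
    have split: "discounted \<mu> g 0 (T + h) x = discounted \<mu> g 0 u x + discounted \<mu> g u (T + h) x"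
      if "0 \<le> u" "u \<le> T + h" for u
      unfolding discounted_def using that
      by (intro Henstock_Kurzweil_Integration.integral_combine[symmetric]
          integrable_discounted(1)[OF g]) auto
    have 1: "P h ?U x = exp (\<mu> * h) * discounted \<mu> g h (T + h) x"
      using P_discounted[OF g _ _ _ U, of h x] T h by simp
    have 2: "P T ?V x = exp (\<mu> * T) * discounted \<mu> g T (T + h) x"
      using P_discounted[OF g _ _ _ V, of T x] T h by (simp add: add.commute)
    have "P T (\<lambda>x. exp (\<mu> * h) / h * ?V x + (- 1) * g x)
        = (\<lambda>x. exp (\<mu> * h) / h * P T ?V x + (- 1) * P T g x)"
      by (rule P_lincomb[OF T V g(1)])
    moreover have "W h = (\<lambda>x. exp (\<mu> * h) / h * ?V x + (- 1) * g x)"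
      by (simp add: W_def fun_eq_iff)
    ultimately have 3: "P T (W h) x = exp (\<mu> * h) / h * P T ?V x - P T g x"
      by simp
    have 4: "discounted \<mu> g h (T + h) x = ?U x + discounted \<mu> g T (T + h) x - ?V x"
      using split[of h] split[of T] T h by simp
    have 5: "exp (- \<mu> * T) * (exp (\<mu> * T) * z) = z" for z
      by (simp add: mult_exp_exp mult.assoc[symmetric])
    have 6: "exp (- \<mu> * T) * P T (W h) x
        = exp (\<mu> * h) / h * discounted \<mu> g T (T + h) x - exp (- \<mu> * T) * P T g x"
      unfolding 3 2 right_diff_distrib using 5 by (simp add: mult.left_commute)
    show ?thesis
      unfolding 1 4 6 W_def using h by (simp add: field_simps)
  qed
  obtain D where D: "\<And>f. f \<in> l2 m \<Longrightarrow> l2_norm m (P T f) \<le> D * l2_norm m f"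
    using P_bounded[OF T] by blast
  have norm_le: "l2_norm m (\<lambda>x. (P h ?U x - ?U x) / h - (- ?h x))
      \<le> \<bar>(exp (\<mu> * h) - 1) / h - \<mu>\<bar> * l2_norm m ?U
        + (l2_norm m (W h) + exp (- \<mu> * T) * (D * l2_norm m (W h)))" if h: "h > 0" for h
  proof -
    note W = W_l2[OF h]
    have "l2_norm m (\<lambda>x. exp (- \<mu> * T) * P T (W h) x) \<le> exp (- \<mu> * T) * (D * l2_norm m (W h))"
      using l2_scale(2)[OF P_l2[OF T W], of "exp (- \<mu> * T)"] D[OF W]
      by (smt (verit) abs_exp_cancel exp_gt_zero mult_left_mono)
    moreover have "l2_norm m (\<lambda>x. - 1 * W h x) \<le> l2_norm m (W h)"
      using l2_scale(2)[OF W, of "-1"] by simp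
    ultimately show ?thesis
      unfolding key[OF h]
      by (intro order.trans[OF l2_add(2)] add_mono order.trans[OF l2_add(2)] l2_add(1) l2_scale
          P_l2 T W U)
  qed
  have W0: "((\<lambda>h. l2_norm m (W h)) \<longlongrightarrow> 0) (at_right 0)"
    unfolding W_def by (rule discounted_average_tendsto[OF g])
  have "((\<lambda>h. exp (\<mu> * h)) has_real_derivative \<mu>) (at 0 within {0<..})"
    by (auto intro!: derivative_eq_intros)
  then have "((\<lambda>h. (exp (\<mu> * h) - 1) / h) \<longlongrightarrow> \<mu>) (at_right 0)"
    by (simp add: has_field_derivative_iff)
  then have "((\<lambda>h. \<bar>(exp (\<mu> * h) - 1) / h - \<mu>\<bar> * l2_norm m ?U
        + (l2_norm m (W h) + exp (- \<mu> * T) * (D * l2_norm m (W h))))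
      \<longlongrightarrow> \<bar>\<mu> - \<mu>\<bar> * l2_norm m ?U + (0 + exp (- \<mu> * T) * (D * 0))) (at_right 0)"
    by (intro tendsto_intros W0)
  then have "((\<lambda>h. \<bar>(exp (\<mu> * h) - 1) / h - \<mu>\<bar> * l2_norm m ?U
        + (l2_norm m (W h) + exp (- \<mu> * T) * (D * l2_norm m (W h)))) \<longlongrightarrow> 0) (at_right 0)"
    by simp
  then have "((\<lambda>h. l2_norm m (\<lambda>x. (P h ?U x - ?U x) / h - (- ?h x))) \<longlongrightarrow> 0) (at_right 0)"
    by (rule Lim_null_comparison[rotated])
      (use eventually_at_right_less[of "0::real"] norm_le l2_norm_nonneg in
        \<open>auto elim!: eventually_mono\<close>)
  then show ?thesis
    using P_generator[OF U hl2] by simp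
qed

end

section \<open>Subsolutions and the Feller property\<close>

definition scaled_indicator :: "real \<Rightarrow> 'a set \<Rightarrow> 'a \<Rightarrow> real" where
  "scaled_indicator c F x = (if x \<in> F then c else 0)"

lemma scaled_indicator_Cc: "finite F \<Longrightarrow> scaled_indicator c F \<in> Cc"
  by (auto simp: Cc_def scaled_indicator_def intro: finite_subset[of _ F])

lemma tendsto_discount:
  fixes \<mu> :: real
  assumes "\<mu> > 0"
  shows "((\<lambda>T. exp (- \<mu> * T)) \<longlongrightarrow> 0) at_top"
proof (rule filterlim_compose[OF exp_at_bot])
  show "filterlim (\<lambda>T. - \<mu> * T) at_bot at_top"
    by (rule filterlim_tendsto_neg_mult_at_bot[OF tendsto_const _ filterlim_ident])
      (use assms in simp)
qed

lemma C0_finite_superlevel: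
  assumes "f \<in> C0" and "e > 0"
  shows "finite {x. e \<le> \<bar>f x\<bar>}"
proof -
  obtain \<phi> where \<phi>: "\<And>n. \<phi> n \<in> Cc" "uniform_limit UNIV \<phi> f sequentially"
    using assms(1) by (auto simp: C0_def)
  from uniform_limitD[OF this(2) assms(2)] obtain n where n: "\<And>x. dist (\<phi> n x) (f x) < e"
    by (auto simp: eventually_sequentially)
  have "\<phi> n x \<noteq> 0" if "e \<le> \<bar>f x\<bar>" for x
    using n[of x] that by (auto simp: dist_real_def)
  then have "{x. e \<le> \<bar>f x\<bar>} \<subseteq> {x. \<phi> n x \<noteq> 0}" by blast
  then show ?thesis using \<phi>(1)[of n] finite_subset by (auto simp: Cc_def)
qed

lemma Cc_subset_C0: "f \<in> Cc \<Longrightarrow> f \<in> C0"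
  unfolding C0_def by (auto intro!: exI[of _ "\<lambda>_. f"] uniform_limit_const)

context stochastically_complete_semigroup
begin

lemma scaled_indicator_l2: "finite F \<Longrightarrow> scaled_indicator c F \<in> l2 m"
  by (rule Cc_subset_l2[OF scaled_indicator_Cc])

lemma scaled_indicator_abs_le: "\<bar>scaled_indicator c F x\<bar> \<le> \<bar>c\<bar>"
  by (simp add: scaled_indicator_def)

lemma discounted_equation:
  assumes "g \<in> l2 m" "\<And>x. \<bar>g x\<bar> \<le> C" and "0 \<le> T"
  shows "formal_laplacian b m (discounted \<mu> g 0 T) x + \<mu> * discounted \<mu> g 0 T x
    = g x - exp (- \<mu> * T) * P T g x"
  using friedrichs_laplacian_pointwise[OF friedrichs_laplacian_discounted[OF assms]] by simp

lemma discounted_form_domain: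
  assumes "g \<in> l2 m" "\<And>x. \<bar>g x\<bar> \<le> C" and "0 \<le> T"
  shows "discounted \<mu> g 0 T \<in> form_domain b m"
  using friedrichs_laplacian_discounted[OF assms] by (auto simp: friedrichs_laplacian_def)

text \<open>
  By stochastic completeness \<open>P\<^sub>t 1\<^sub>F\<close> increases to 1 as \<open>F\<close> exhausts the graph, so the limit is
  the integral of \<open>c \<mu> e\<^sup>-\<^sup>\<mu>\<^sup>t\<close> from 0 to \<open>T\<close>.
\<close>

lemma discounted_exhaustion_tendsto:
  assumes "\<mu> > 0" and "0 \<le> T"
    and fin: "\<And>n. finite (F n)" and F: "filterlim F (finite_subsets_at_top UNIV) sequentially"
  shows "(\<lambda>n. discounted \<mu> (scaled_indicator (c * \<mu>) (F n)) 0 T x)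
    \<longlonglongrightarrow> c * (1 - exp (- \<mu> * T))"
proof -
  let ?g = "\<lambda>n. scaled_indicator (c * \<mu>) (F n)"
  note g = scaled_indicator_l2[OF fin] scaled_indicator_abs_le
  have P: "P t (?g n) x = (c * \<mu>) * (\<Sum>y\<in>F n. p t x y * m y)" if "0 \<le> t" for t n
  proof -
    have "((\<lambda>y. p t x y * ?g n y * m y) has_sum (\<Sum>y\<in>F n. p t x y * ?g n y * m y)) UNIV"
      by (rule has_sum_finite_neutralI[of "F n"]) (auto simp: fin scaled_indicator_def)
    then have "P t (?g n) x = (\<Sum>y\<in>F n. p t x y * ?g n y * m y)"
      using P_has_sum[OF that g(1)] has_sum_unique by blast
    then show ?thesis by (simp add: scaled_indicator_def sum_distrib_left mult_ac)
  qed
  have "(\<lambda>n. integral {0..T} (\<lambda>t. exp (- \<mu> * t) * P t (?g n) x))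
      \<longlonglongrightarrow> integral {0..T} (\<lambda>t. exp (- \<mu> * t) * (c * \<mu>))"
  proof (rule dominated_convergence(2))
    show "(\<lambda>t. exp (- \<mu> * t) * P t (?g n) x) integrable_on {0..T}" for n
      by (rule integrable_discounted(1)[OF g]) simp
    show "(\<lambda>t. \<bar>c * \<mu>\<bar>) integrable_on {0..T}" by (rule integrable_const_ivl)
    show "norm (exp (- \<mu> * t) * P t (?g n) x) \<le> \<bar>c * \<mu>\<bar>" if "t \<in> {0..T}" for n t
    proof -
      have "\<bar>exp (- \<mu> * t)\<bar> * \<bar>P t (?g n) x\<bar> \<le> 1 * \<bar>c * \<mu>\<bar>"
        using that assms(1) by (intro mult_mono P_abs_le g) auto
      then show ?thesis by (simp add: abs_mult)
    qed
    show "(\<lambda>n. exp (- \<mu> * t) * P t (?g n) x) \<longlonglongrightarrow> exp (- \<mu> * t) * (c * \<mu>)"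
      if t: "t \<in> {0..T}" for t
    proof -
      have "(\<lambda>n. \<Sum>y\<in>F n. p t x y * m y) \<longlonglongrightarrow> 1"
        using p_has_sum_1[of t x] t unfolding has_sum_def
        by (auto intro: filterlim_compose[OF _ F])
      then have "(\<lambda>n. exp (- \<mu> * t) * ((c * \<mu>) * (\<Sum>y\<in>F n. p t x y * m y)))
          \<longlonglongrightarrow> exp (- \<mu> * t) * ((c * \<mu>) * 1)"
        by (intro tendsto_intros)
      then show ?thesis using t by (simp add: P)
    qed
  qed
  moreover have "((\<lambda>t. exp (- \<mu> * t) * (c * \<mu>)) has_integral
      - c * exp (- \<mu> * T) - (- c * exp (- \<mu> * 0))) {0..T}"
    using assms(2) by (intro fundamental_theorem_of_calculus)
      (auto intro!: derivative_eq_intros simp flip: has_real_derivative_iff_has_vector_derivative)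
  ultimately have "(\<lambda>n. integral {0..T} (\<lambda>t. exp (- \<mu> * t) * P t (?g n) x))
      \<longlonglongrightarrow> - c * exp (- \<mu> * T) - (- c * exp (- \<mu> * 0))"
    by (simp only: integral_unique)
  then show ?thesis
    by (simp add: discounted_def right_diff_distrib)
qed

lemma finite_exhaustion:
  obtains F :: "nat \<Rightarrow> 'a set" where "\<And>n. finite (F n)"
    and "filterlim F (finite_subsets_at_top UNIV) sequentially"
proof -
  define F where "F n = {x :: 'a. to_nat_on UNIV x < n}" for n
  have fin: "finite (F n)" for n
  proof -
    have "finite (to_nat_on (UNIV :: 'a set) -` {..<n})"
      by (intro finite_vimageI inj_on_to_nat_on countable_vertices) simp
    then show ?thesis by (simp add: F_def vimage_def)
  qed
  have "filterlim F (finite_subsets_at_top UNIV) sequentially"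
    unfolding filterlim_finite_subsets_at_top
  proof (intro allI impI)
    fix X :: "'a set" assume X: "finite X \<and> X \<subseteq> UNIV"
    have "\<forall>\<^sub>F n in sequentially. \<forall>x\<in>X. to_nat_on UNIV x < n"
      using X by (intro eventually_ball_finite) (auto intro: eventually_gt_at_top)
    then show "\<forall>\<^sub>F n in sequentially. finite (F n) \<and> X \<subseteq> F n \<and> F n \<subseteq> UNIV"
      by (rule eventually_mono) (auto simp: fin, simp add: F_def)
  qed
  then show thesis using that fin by blast
qed

text \<open>
  Stochastic completeness enters through \<open>M - v\<close>, where \<open>v\<close> is the truncated resolvent of
  \<open>\<mu> M\<close> times the indicator of a large finite set. This is a supersolution which differs from
  \<open>M\<close> by a function in the form domain, so that it controls any function bounded by \<open>M\<close> from
  outside, whereas on a fixed vertex it tends to 0 as the set grows and \<open>T'\<close> tends to infinity.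
  On \<open>K\<close> the failure of \<open>f\<close> to be a subsolution is compensated by the resolvent of the indicator
  of \<open>K\<close>; its truncation error \<open>C e\<^sup>-\<^sup>\<mu>\<^sup>T\<close> is absorbed by the additive constant.
\<close>

lemma bounded_exterior_subsolution_le:
  assumes "\<mu> > 0" and K: "finite K" and "0 \<le> C" "0 \<le> M" "0 \<le> T"
    and f_le: "\<And>x. f x \<le> M"
    and sub: "\<And>x. formal_laplacian b m f x + \<mu> * f x \<le> scaled_indicator C K x"
  shows "f x \<le> discounted \<mu> (scaled_indicator C K) 0 T x + C * exp (- \<mu> * T) / \<mu>"
proof -
  define \<epsilon> where "\<epsilon> = C * exp (- \<mu> * T) / \<mu>"
  have \<epsilon>: "\<mu> * \<epsilon> = C * exp (- \<mu> * T)" "0 \<le> \<epsilon>"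
    using assms by (auto simp: \<epsilon>_def)
  let ?u = "discounted \<mu> (scaled_indicator C K) 0 T"
  note gK = scaled_indicator_l2[OF K] scaled_indicator_abs_le
  have main: "f x \<le> ?u x + \<epsilon> + M - discounted \<mu> (scaled_indicator (M * \<mu>) F) 0 T' x"
    if F: "finite F" and T': "0 \<le> T'" for F T'
  proof -
    let ?v = "discounted \<mu> (scaled_indicator (M * \<mu>) F) 0 T'"
    define w where "w x = (f x - ?u x) - ((\<epsilon> + M) - ?v x)" for x
    note gF = scaled_indicator_l2[OF F] scaled_indicator_abs_le
    have v0: "0 \<le> ?v x" for x
      using assms by (intro discounted_nonneg[OF gF]) (auto simp: scaled_indicator_def)
    have u0: "0 \<le> ?u x" for x
      using assms by (intro discounted_nonneg[OF gK]) (auto simp: scaled_indicator_def)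
    have "w x \<le> 0"
    proof (rule subsolution_comparison[OF assms(1)])
      show "?v \<in> form_domain b m"
        by (rule discounted_form_domain[OF gF T'])
      show "w x \<le> ?v x" for x
        using f_le[of x] u0[of x] \<epsilon>(2) by (simp add: w_def)
      show "0 \<le> ?v x" for x by (rule v0)
      fix x
      have "P T (scaled_indicator C K) x \<le> C"
        using assms by (intro P_le gK) (auto simp: scaled_indicator_def)
      then have 1: "exp (- \<mu> * T) * P T (scaled_indicator C K) x \<le> \<mu> * \<epsilon>"
        unfolding \<epsilon> by simp
      have 2: "0 \<le> exp (- \<mu> * T') * P T' (scaled_indicator (M * \<mu>) F) x"
        using assms T' by (intro mult_nonneg_nonneg P_nonneg gF) (auto simp: scaled_indicator_def)
      have 3: "scaled_indicator (M * \<mu>) F x \<le> M * \<mu>"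
        using assms by (simp add: scaled_indicator_def)
      have "formal_laplacian b m w x = formal_laplacian b m f x - formal_laplacian b m ?u x
          + formal_laplacian b m ?v x"
        unfolding w_def by (simp add: formal_laplacian_diff formal_laplacian_const)
      then have "formal_laplacian b m w x + \<mu> * w x
          = (formal_laplacian b m f x + \<mu> * f x) - (formal_laplacian b m ?u x + \<mu> * ?u x)
            + (formal_laplacian b m ?v x + \<mu> * ?v x) - \<mu> * \<epsilon> - M * \<mu>"
        by (simp add: w_def algebra_simps)
      also have "\<dots> \<le> 0"
        unfolding discounted_equation[OF gK assms(5)] discounted_equation[OF gF T']
        using sub[of x] 1 2 3 by linarith
      finally show "formal_laplacian b m w x + \<mu> * w x \<le> 0" .
    qed
    then show ?thesis by (simp add: w_def)
  qed
  obtain F :: "nat \<Rightarrow> 'a set" where F: "\<And>n. finite (F n)"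
    "filterlim F (finite_subsets_at_top UNIV) sequentially"
    using finite_exhaustion by blast
  have "f x \<le> ?u x + \<epsilon> + M - M * (1 - exp (- \<mu> * T'))" if T': "0 \<le> T'" for T'
  proof (rule LIMSEQ_le_const)
    show "(\<lambda>n. ?u x + \<epsilon> + M - discounted \<mu> (scaled_indicator (M * \<mu>) (F n)) 0 T' x)
        \<longlonglongrightarrow> ?u x + \<epsilon> + M - M * (1 - exp (- \<mu> * T'))"
      by (intro tendsto_intros discounted_exhaustion_tendsto assms(1) T' F)
  qed (use main F(1) T' in blast)
  then have *: "f x \<le> ?u x + \<epsilon> + M * exp (- \<mu> * T')" if "0 \<le> T'" for T'
    using that by (simp add: algebra_simps)
  have "((\<lambda>T'. ?u x + \<epsilon> + M * exp (- \<mu> * T')) \<longlongrightarrow> ?u x + \<epsilon> + M * 0) at_top"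
    by (intro tendsto_intros tendsto_discount assms(1))
  then have "f x \<le> ?u x + \<epsilon> + M * 0"
    by (rule tendsto_lowerbound[OF _ eventually_mono[OF eventually_ge_at_top[of 0] *]]) simp_all
  then show ?thesis by (simp add: \<epsilon>_def)
qed

text \<open>
  The Feller property makes the integrand vanish at infinity for each time separately. Dominated
  convergence along a sequence of distinct vertices transfers this to the integral.
\<close>

lemma feller_discounted_vanishes:
  assumes "feller m p" and "g \<in> Cc" "\<And>x. \<bar>g x\<bar> \<le> C" and "\<mu> > 0" "0 \<le> T" "e > 0"
  shows "finite {x. e \<le> discounted \<mu> g 0 T x}"
proof (rule ccontr)
  assume "infinite {x. e \<le> discounted \<mu> g 0 T x}"
  from infinite_countable_subset[OF this] obtain s :: "nat \<Rightarrow> 'a"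
    where s: "inj s" "range s \<subseteq> {x. e \<le> discounted \<mu> g 0 T x}" by blast
  have s_ge: "e \<le> discounted \<mu> g 0 T (s n)" for n using s(2) by auto
  note g = Cc_subset_l2[OF assms(2)] assms(3)
  have lim: "(\<lambda>n. P t g (s n)) \<longlonglongrightarrow> 0" if t: "0 \<le> t" for t
  proof (rule LIMSEQ_I)
    fix r :: real assume "r > 0"
    have "heat_action m p t g = P t g"
      unfolding heat_action_def fun_eq_iff using P_has_sum[OF t g(1)] infsumI by blast
    then have "P t g \<in> C0"
      using assms(1) Cc_subset_C0[OF assms(2)] t by (metis feller_def)
    from finite_vimageI[OF C0_finite_superlevel[OF this \<open>r > 0\<close>] s(1)]
    have "finite {n. r \<le> \<bar>P t g (s n)\<bar>}" by (simp add: vimage_def)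
    then obtain N where "\<forall>n\<in>{n. r \<le> \<bar>P t g (s n)\<bar>}. n \<le> N"
      using finite_nat_set_iff_bounded_le by blast
    then show "\<exists>no. \<forall>n\<ge>no. norm (P t g (s n) - 0) < r"
      by (intro exI[of _ "Suc N"]) (auto simp: not_less_eq_eq[symmetric] not_le[symmetric])
  qed
  have "(\<lambda>n. integral {0..T} (\<lambda>t. exp (- \<mu> * t) * P t g (s n)))
      \<longlonglongrightarrow> integral {0..T} (\<lambda>t. 0)"
  proof (rule dominated_convergence(2))
    show "(\<lambda>t. exp (- \<mu> * t) * P t g (s n)) integrable_on {0..T}" for n
      by (rule integrable_discounted(1)[OF g]) simp
    show "(\<lambda>t. C) integrable_on {0..T}" by (rule integrable_const_ivl)
    show "norm (exp (- \<mu> * t) * P t g (s n)) \<le> C" if "t \<in> {0..T}" for n t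
    proof -
      have "\<bar>exp (- \<mu> * t)\<bar> * \<bar>P t g (s n)\<bar> \<le> 1 * C"
        using that assms(4) by (intro mult_mono P_abs_le g) auto
      then show ?thesis by (simp add: abs_mult)
    qed
    show "(\<lambda>n. exp (- \<mu> * t) * P t g (s n)) \<longlonglongrightarrow> 0" if "t \<in> {0..T}" for t
      using tendsto_mult[OF tendsto_const[of "exp (- \<mu> * t)"] lim[of t]] that by simp
  qed
  then have "(\<lambda>n. discounted \<mu> g 0 T (s n)) \<longlonglongrightarrow> 0"
    by (simp add: discounted_def)
  then have "e \<le> 0"
    by (rule tendsto_lowerbound) (simp_all add: s_ge)
  with assms(6) show False by simp
qed

end

section \<open>Spherically symmetric functions\<close>

context weighted_graph
begin

lemma finite_ball:
  assumes "graph_connected b"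
  shows "finite {x. graph_dist b x x0 \<le> n}"
proof -
  have fin: "finite {x. (adj b ^^ k) x x0}" for k
  proof (induction k)
    case (Suc k)
    have "{x. (adj b ^^ Suc k) x x0} \<subseteq> (\<Union>z\<in>{z. (adj b ^^ k) z x0}. {x. b z x > 0})"
    proof
      fix x assume "x \<in> {x. (adj b ^^ Suc k) x x0}"
      then obtain z where "adj b x z" "(adj b ^^ k) z x0"
        using relpowp_Suc_D2[of k "adj b" x x0] by blast
      then show "x \<in> (\<Union>z\<in>{z. (adj b ^^ k) z x0}. {x. b z x > 0})"
        by (auto simp: adj_def weight_sym)
    qed
    then show ?case
      by (rule finite_subset) (intro finite_UN_I Suc.IH locally_finite)
  qed (simp add: eq_commute)
  have "{x. graph_dist b x x0 \<le> n} \<subseteq> (\<Union>k\<le>n. {x. (adj b ^^ k) x x0})"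
  proof
    fix x assume "x \<in> {x. graph_dist b x x0 \<le> n}"
    moreover have "(adj b ^^ graph_dist b x x0) x x0"
      using assms unfolding graph_dist_def graph_connected_def by (meson LeastI_ex)
    ultimately show "x \<in> (\<Union>k\<le>n. {x. (adj b ^^ k) x x0})" by auto
  qed
  then show ?thesis
    by (rule finite_subset) (simp add: fin)
qed

lemma graph_dist_adj_le:
  assumes "graph_connected b" and "b x y > 0"
  shows "graph_dist b x x0 \<le> Suc (graph_dist b y x0)"
proof -
  have "(adj b ^^ graph_dist b y x0) y x0"
    using assms(1) unfolding graph_dist_def graph_connected_def by (meson LeastI_ex)
  with assms(2) have "(adj b ^^ Suc (graph_dist b y x0)) x x0"
    by (intro relpowp_Suc_I2) (simp add: adj_def)
  then show ?thesis unfolding graph_dist_def by (rule Least_le)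
qed

lemma radial_value_eq:
  assumes "spherically_symmetric b x0 f"
  shows "radial_value b x0 f (graph_dist b x x0) = f x"
proof -
  have "f ` graph_sphere b x0 (int (graph_dist b x x0)) = {f x}"
  proof -
    have "x \<in> graph_sphere b x0 (int (graph_dist b x x0))" by (simp add: graph_sphere_def)
    moreover have "f y = f x" if "y \<in> graph_sphere b x0 (int (graph_dist b x x0))" for y
      using assms[unfolded spherically_symmetric_def, rule_format, of y x] that
      by (simp add: graph_sphere_def)
    ultimately show ?thesis by blast
  qed
  then show ?thesis by (simp add: radial_value_def)
qed

lemma infsum_sphere:
  "(\<Sum>\<^sub>\<infinity>y\<in>S. b x y) = (\<Sum>y | b x y > 0. if y \<in> S then b x y else 0)"
proof -
  have "(\<Sum>\<^sub>\<infinity>y\<in>S. b x y) = (\<Sum>\<^sub>\<infinity>y\<in>{y. b x y > 0} \<inter> S. b x y)"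
    by (rule infsum_cong_neutral) (use weight_nonneg[of x] in \<open>force simp: order.order_iff_strict\<close>)+
  then show ?thesis
    by (simp add: locally_finite sum.inter_restrict)
qed

text \<open>
  Neighbours of \<open>x\<close> lie on the sphere of \<open>x\<close> and on the two adjacent ones, and \<open>f\<close> does not
  change along edges inside a sphere.
\<close>

lemma formal_laplacian_spherically_symmetric:
  assumes "graph_connected b" and sym: "spherically_symmetric b x0 f"
    and r: "graph_dist b x x0 = r" "r > 0"
  shows "formal_laplacian b m f x = outer_curvature b m x0 x * radial_diff b x0 f r
    - inner_curvature b m x0 x * radial_diff b x0 f (r - 1)"
proof -
  let ?S = "\<lambda>k. graph_sphere b x0 k"
  have edge: "b x y * (f x - f y) = (if y \<in> ?S (int r + 1) then b x y else 0) * radial_diff b x0 f r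
      - (if y \<in> ?S (int r - 1) then b x y else 0) * radial_diff b x0 f (r - 1)"
    if y: "b x y > 0" for y
  proof -
    let ?d = "graph_dist b y x0"
    have fx: "f x = radial_value b x0 f r" and fy: "f y = radial_value b x0 f ?d"
      using radial_value_eq[OF sym, of x] radial_value_eq[OF sym, of y] r by simp_all
    have "r \<le> Suc ?d" "?d \<le> Suc r"
      using graph_dist_adj_le[OF assms(1), of x y x0] graph_dist_adj_le[OF assms(1), of y x x0]
        y r weight_sym[of x y] by auto
    then consider "?d = r + 1" | "?d = r" | "?d = r - 1" "r = ?d + 1" by linarith
    then show ?thesis
      by cases (use r(2) in \<open>auto simp: fx fy graph_sphere_def radial_diff_def algebra_simps\<close>)
  qed
  have "formal_laplacian b m f x = (\<Sum>y | b x y > 0.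
      (if y \<in> ?S (int r + 1) then b x y else 0) * radial_diff b x0 f r
      - (if y \<in> ?S (int r - 1) then b x y else 0) * radial_diff b x0 f (r - 1)) / m x"
    unfolding formal_laplacian_def using edge by (intro arg_cong2[of _ _ _ _ "(/)"] sum.cong) auto
  also have "\<dots> = outer_curvature b m x0 x * radial_diff b x0 f r
    - inner_curvature b m x0 x * radial_diff b x0 f (r - 1)"
    unfolding outer_curvature_def inner_curvature_def r(1) infsum_sphere sum_subtractf
      diff_divide_distrib sum_distrib_right[symmetric]
    by simp
  finally show ?thesis .
qed

end

text \<open>
  The radial values decrease from \<open>R\<close> on, and positivity of \<open>f\<close> at points of arbitrarily large
  distance keeps them positive, so they converge; the limit is the lower bound sought.
\<close>

lemma decreasing_radial_lower_bound:
  assumes "weighted_graph b m" and "graph_connected b" and "\<And>x. 0 < f x"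
    and sym: "spherically_symmetric b x0 f"
    and decr: "\<And>r. r > R \<Longrightarrow> radial_diff b x0 f r > 0"
    and not0: "\<not> (radial_value b x0 f \<longlonglongrightarrow> 0)"
  shows "\<exists>c>0. \<forall>x. graph_dist b x x0 > R \<longrightarrow> c \<le> f x"
proof -
  interpret weighted_graph b m by fact
  let ?f = "radial_value b x0 f"
  have mono: "?f s \<le> ?f r" if "R < r" "r \<le> s" for r s
    using that(2,1)
  proof (induction rule: dec_induct)
    case (step n)
    then show ?case using decr[of n] by (simp add: radial_diff_def)
  qed simp
  have pos: "0 < ?f r" if "R < r" for r
  proof -
    have "{x. graph_dist b x x0 \<le> r} \<noteq> UNIV"
      using finite_ball[OF assms(2)] infinite_vertices by metis
    then obtain x where "\<not> graph_dist b x x0 \<le> r" by blast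
    then have "r \<le> graph_dist b x x0" by simp
    from mono[OF that this] show ?thesis
      using assms(3)[of x] radial_value_eq[OF sym, of x] by simp
  qed
  have decseq: "decseq (\<lambda>n. ?f (n + Suc R))"
    by (auto simp: decseq_def intro!: mono)
  have "0 \<le> ?f (n + Suc R)" for n
    by (simp add: pos less_imp_le)
  with decseq obtain L where L: "(\<lambda>n. ?f (n + Suc R)) \<longlonglongrightarrow> L" "\<And>n. L \<le> ?f (n + Suc R)"
    using decseq_convergent[of "\<lambda>n. ?f (n + Suc R)" 0] by blast
  have "0 \<le> L"
    by (rule tendsto_lowerbound[OF L(1)]) (auto simp: pos less_imp_le)
  moreover have "L \<noteq> 0"
    using not0 L(1) LIMSEQ_offset by blast
  moreover have "L \<le> f x" if "graph_dist b x x0 > R" for x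
    using L(2)[of "graph_dist b x x0 - Suc R"] that radial_value_eq[OF sym, of x] by simp
  ultimately show ?thesis by (intro exI[of _ L]) auto
qed

theorem theorem4p10:
  fixes b :: "'a \<Rightarrow> 'a \<Rightarrow> real" and m :: "'a \<Rightarrow> real"
    and p :: "real \<Rightarrow> 'a \<Rightarrow> 'a \<Rightarrow> real"
    and x0 :: 'a and f :: "'a \<Rightarrow> real" and R :: nat and lam :: real
  assumes "weighted_graph b m"
    and "graph_connected b"
    and "heat_kernel b m p"
    and "stochastically_complete m p"
    and "\<And>x. 0 < f x"
    and "bounded (range f)"
    and "spherically_symmetric b x0 f"
    and "\<And>r. r > R \<Longrightarrow> radial_diff b x0 f r > 0"
    and "\<not> (radial_value b x0 f \<longlonglongrightarrow> 0)"
    and "lam < 0"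
    and "\<And>r x. r > R \<Longrightarrow> x \<in> graph_sphere b x0 (int r) \<Longrightarrow>
           outer_curvature b m x0 x
             - inner_curvature b m x0 x * (radial_diff b x0 f (r - 1) / radial_diff b x0 f r)
           \<le> lam * (radial_value b x0 f r / radial_diff b x0 f r)"
  shows "\<not> feller m p"
proof
  assume feller: "feller m p"
  obtain P where P: "heat_semigroup b m P"
    "\<And>t f x. 0 \<le> t \<Longrightarrow> f \<in> l2 m \<Longrightarrow> ((\<lambda>y. p t x y * f y * m y) has_sum P t f x) UNIV"
    using assms(3) unfolding heat_kernel_def by blast
  interpret weighted_graph b m by fact
  interpret stochastically_complete_semigroup b m p P
    using assms(3,4) P
    by unfold_locales (auto simp: heat_kernel_def stochastically_complete_def)
  define \<mu> where "\<mu> = - lam"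
  have \<mu>: "\<mu> > 0" using assms(10) by (simp add: \<mu>_def)
  define K where "K = {x. graph_dist b x x0 \<le> R}"
  have K: "finite K" unfolding K_def by (rule finite_ball[OF assms(2)])
  have outside: "formal_laplacian b m f x + \<mu> * f x \<le> 0" if "x \<notin> K" for x
  proof -
    define r where "r = graph_dist b x x0"
    have r: "r > R" using that by (simp add: K_def r_def)
    let ?D = "radial_diff b x0 f r"
    have D: "?D > 0" by (rule assms(8)[OF r])
    have "x \<in> graph_sphere b x0 (int r)" by (simp add: graph_sphere_def r_def)
    from mult_right_mono[OF assms(11)[OF r this] less_imp_le[OF D]]
    have "outer_curvature b m x0 x * ?D - inner_curvature b m x0 x * radial_diff b x0 f (r - 1)
        \<le> lam * radial_value b x0 f r"
      using D by (simp add: left_diff_distrib)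
    then show ?thesis
      using formal_laplacian_spherically_symmetric[OF assms(2,7) r_def[symmetric]] r
        radial_value_eq[OF assms(7), of x]
      by (simp add: \<mu>_def r_def)
  qed
  define C where "C = Max (insert 0 ((\<lambda>x. formal_laplacian b m f x + \<mu> * f x) ` K))"
  have C0: "0 \<le> C" unfolding C_def using K by (intro Max_ge) auto
  have sub: "formal_laplacian b m f x + \<mu> * f x \<le> scaled_indicator C K x" for x
  proof (cases "x \<in> K")
    case True
    then have "formal_laplacian b m f x + \<mu> * f x \<le> C"
      unfolding C_def using K by (intro Max_ge) auto
    then show ?thesis using True by (simp add: scaled_indicator_def)
  qed (simp add: outside scaled_indicator_def)
  obtain M where M: "\<And>x. f x \<le> M"
    using assms(6) unfolding bounded_iff by (auto simp: abs_le_iff)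
  have M0: "0 \<le> M" using M[of x0] assms(5)[of x0] by simp
  obtain c where c: "c > 0" "\<And>x. x \<notin> K \<Longrightarrow> c \<le> f x"
    using decreasing_radial_lower_bound[OF assms(1,2,5,7,8,9)] by (auto simp: K_def not_le)
  have "((\<lambda>T. C * exp (- \<mu> * T) / \<mu>) \<longlongrightarrow> C * 0 / \<mu>) at_top"
    using \<mu> by (intro tendsto_intros tendsto_discount) auto
  then have "\<forall>\<^sub>F T in at_top. C * exp (- \<mu> * T) / \<mu> < c / 2"
    by (rule order_tendstoD) (use c in auto)
  then have "\<forall>\<^sub>F T in at_top. C * exp (- \<mu> * T) / \<mu> < c / 2 \<and> 0 \<le> T"
    using eventually_ge_at_top[of 0] by (rule eventually_conj)
  then obtain T where T: "C * exp (- \<mu> * T) / \<mu> < c / 2" "0 \<le> T"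
    unfolding eventually_at_top_linorder by blast
  have "finite {x. c / 2 \<le> discounted \<mu> (scaled_indicator C K) 0 T x}"
    using c by (intro feller_discounted_vanishes[OF feller scaled_indicator_Cc[OF K]
          scaled_indicator_abs_le \<mu> T(2)]) auto
  moreover have "- K \<subseteq> {x. c / 2 \<le> discounted \<mu> (scaled_indicator C K) 0 T x}"
  proof
    fix x assume "x \<in> - K"
    then have "c \<le> f x" using c(2) by simp
    with bounded_exterior_subsolution_le[OF \<mu> K C0 M0 T(2) M sub, of x] T(1)
    have "c / 2 \<le> discounted \<mu> (scaled_indicator C K) 0 T x" by linarith
    then show "x \<in> {x. c / 2 \<le> discounted \<mu> (scaled_indicator C K) 0 T x}" by simp
  qed
  ultimately have "finite (- K)" using finite_subset by blast
  with K infinite_vertices show False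
    by (metis Compl_partition finite_Un)
qed

end
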